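(* Let $n\geq 3$ and $m\geq 1$. Then $$\operatorname{depth}(S_{n,m}/I(\mathcal{C}_{n,m}))\leq\begin{cases} \left\lceil\frac{n-1}{3}\right\rceil+\left(\left\lceil\frac{m}{3}\right\rceil-1\right)\left\lceil\frac{n}{3}\right\rceil, & \text{if } m\equiv 1,2 \pmod 3,\\[4pt] \left\lceil\frac{n}{3}\right\rceil\left\lceil\frac{m}{3}\right\rceil, & \text{if } m\equiv 0\pmod 3. \end{cases}$$
   Context: $K$ is a field. For a finite simple graph $G$ whose vertices are the variables of a polynomial ring over $K$, the edge ideal $I(G)$ is the squarefree monomial ideal generated by all products $uv$ with $\{u,v\}\in E(G)$. $P_m$ is the path on $m$ vertices ($P_1$ is a single vertex with no edges) and $C_n$ ($n\ge 3$) is the cycle on $n$ vertices. The strong product $G_1\boxtimes G_2$ has vertex set $V(G_1)\times V(G_2)$, and two distinct vertices $(v_1,u_1),(v_2,u_2)$ are adjacent iff each coordinate pair is equal or adjacent ($v_1=v_2$ or $v_1v_2\in E(G_1)$, and $u_1=u_2$ or $u_1u_2\in E(G_2)$). Put $\mathcal{C}_{n,m}:=C_n\boxtimes P_m$, with vertices labelled by variables $x_{ij}$ ($1\le i\le n$, $1\le j\le m$), so that distinct $x_{ij},x_{kl}$ are adjacent iff $i-k\in\{-1,0,1\}$ modulo $n$ and $|j-l|\le 1$. $S_{n,m}:=K[x_{ij}:1\le i\le n,\ 1\le j\le m]$. Depth is taken with respect to the graded maximal ideal generated by all the variables. *)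

theory Defs
  imports
    "HOL-Library.Poly_Mapping"
    "HOL-Library.Extended_Nat"
    "HOL-Algebra.QuotRing"
    "HOL-Algebra.Module"
    "Graph_Theory.Pair_Digraph"
    Complex_Main
begin

section \<open>Polynomial rings with a given set of variables\<close>

text \<open>
  A polynomial is a finitely supported map from exponent vectors to coefficients.
  The type \<^typ>\<open>('v \<Rightarrow>\<^sub>0 nat) \<Rightarrow>\<^sub>0 'k\<close> has every element of \<^typ>\<open>'v\<close> as a variable;
  the carrier restricts to those polynomials in which only variables from \<^term>\<open>V\<close> occur.
\<close>

definition polynomial_ring :: "'v set \<Rightarrow> (('v \<Rightarrow>\<^sub>0 nat) \<Rightarrow>\<^sub>0 'k::field) ring" where
  "polynomial_ring V =
     \<lparr>carrier = {p. \<forall>t \<in> Poly_Mapping.keys p. Poly_Mapping.keys t \<subseteq> V},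
      monoid.mult = (*), one = 1, zero = 0, add = (+)\<rparr>"

definition var :: "'v \<Rightarrow> (('v \<Rightarrow>\<^sub>0 nat) \<Rightarrow>\<^sub>0 'k::field)" where
  "var v = Poly_Mapping.single (Poly_Mapping.single v 1) 1"

definition graded_maximal_ideal :: "'v set \<Rightarrow> (('v \<Rightarrow>\<^sub>0 nat) \<Rightarrow>\<^sub>0 'k::field) set" where
  "graded_maximal_ideal V = genideal (polynomial_ring V) (var ` V)"

lemma cring_polynomial_ring:
  "cring (polynomial_ring V :: (('v \<Rightarrow>\<^sub>0 nat) \<Rightarrow>\<^sub>0 'k::field) ring)"
proof -
  have mult: "p * q \<in> carrier (polynomial_ring V)"
    if p: "p \<in> carrier (polynomial_ring V)" and q: "q \<in> carrier (polynomial_ring V)"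
    for p q :: "('v \<Rightarrow>\<^sub>0 nat) \<Rightarrow>\<^sub>0 'k"
    unfolding polynomial_ring_def
  proof (clarsimp)
    fix t x assume "t \<in> Poly_Mapping.keys (p * q)" and x: "x \<in> Poly_Mapping.keys t"
    then obtain a b where t: "t = a + b" "a \<in> Poly_Mapping.keys p" "b \<in> Poly_Mapping.keys q"
      using keys_mult[of p q] by blast
    have "x \<in> Poly_Mapping.keys a \<union> Poly_Mapping.keys b"
      using x t(1) Poly_Mapping.keys_add[of a b] by auto
    then show "x \<in> V"
      using p q t by (auto simp: polynomial_ring_def)
  qed
  have add: "p + q \<in> carrier (polynomial_ring V)"
    if "p \<in> carrier (polynomial_ring V)" and "q \<in> carrier (polynomial_ring V)"
    for p q :: "('v \<Rightarrow>\<^sub>0 nat) \<Rightarrow>\<^sub>0 'k"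
    using that Poly_Mapping.keys_add[of p q] by (fastforce simp: polynomial_ring_def)
  have neg: "\<exists>q \<in> carrier (polynomial_ring V). q + p = 0"
    if "p \<in> carrier (polynomial_ring V)" for p :: "('v \<Rightarrow>\<^sub>0 nat) \<Rightarrow>\<^sub>0 'k"
    using that by (intro bexI[of _ "- p"]) (auto simp: polynomial_ring_def in_keys_iff)
  have [simp]: "zero (polynomial_ring V) = (0 :: ('v \<Rightarrow>\<^sub>0 nat) \<Rightarrow>\<^sub>0 'k)"
    "one (polynomial_ring V) = (1 :: ('v \<Rightarrow>\<^sub>0 nat) \<Rightarrow>\<^sub>0 'k)"
    "x \<oplus>\<^bsub>polynomial_ring V\<^esub> y = x + y" "x \<otimes>\<^bsub>polynomial_ring V\<^esub> y = x * y"
    for x y :: "('v \<Rightarrow>\<^sub>0 nat) \<Rightarrow>\<^sub>0 'k"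
    by (simp_all add: polynomial_ring_def)
  have [simp]: "(0 :: ('v \<Rightarrow>\<^sub>0 nat) \<Rightarrow>\<^sub>0 'k) \<in> carrier (polynomial_ring V)"
    "(1 :: ('v \<Rightarrow>\<^sub>0 nat) \<Rightarrow>\<^sub>0 'k) \<in> carrier (polynomial_ring V)"
    by (simp_all add: polynomial_ring_def)
  show ?thesis
  proof (rule cringI)
    show "abelian_group (polynomial_ring V :: (('v \<Rightarrow>\<^sub>0 nat) \<Rightarrow>\<^sub>0 'k) ring)"
      by (rule abelian_groupI) (use add neg in \<open>simp_all add: add.assoc add.commute\<close>)
    show "Group.comm_monoid (polynomial_ring V :: (('v \<Rightarrow>\<^sub>0 nat) \<Rightarrow>\<^sub>0 'k) ring)"
      by (rule comm_monoidI) (use mult in \<open>simp_all add: mult.assoc mult.commute\<close>)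
  qed (simp add: distrib_right)
qed

section \<open>Depth of a module\<close>

definition quotient_module :: "('a, 'm) ring_scheme \<Rightarrow> 'a set \<Rightarrow> ('a, 'a set) module" where
  "quotient_module R I =
     \<lparr>carrier = carrier (R Quot I), monoid.mult = monoid.mult (R Quot I), one = one (R Quot I),
      zero = zero (R Quot I), add = add (R Quot I),
      smult = (\<lambda>r X. (I +>\<^bsub>R\<^esub> r) \<otimes>\<^bsub>R Quot I\<^esub> X)\<rparr>"

lemma module_quotient_module:
  assumes "cring R" "ideal I R"
  shows "Module.module R (quotient_module R I)"
proof -
  interpret Q: cring "R Quot I"
    by (rule ideal.quotient_is_cring[OF assms(2,1)])
  interpret h: ring_hom_ring R "R Quot I" "(+>\<^bsub>R\<^esub>) I"
    by (rule ideal.rcos_ring_hom_ring[OF assms(2)])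
  have simps: "carrier (quotient_module R I) = carrier (R Quot I)"
    "zero (quotient_module R I) = zero (R Quot I)" "add (quotient_module R I) = add (R Quot I)"
    "smult (quotient_module R I) r X = (I +>\<^bsub>R\<^esub> r) \<otimes>\<^bsub>R Quot I\<^esub> X" for r X
    by (simp_all add: quotient_module_def)
  have ag: "abelian_group (quotient_module R I)"
    by (rule abelian_groupI, unfold simps)
       (fact abelian_groupE[OF Q.abelian_group_axioms])+
  show ?thesis
    by (rule moduleI)
       (simp_all add: assms(1) ag simps Q.l_distr Q.r_distr Q.m_assoc)
qed

text \<open>\<open>smult_span R M A\<close> is the submodule \<open>(A)M\<close>, where \<open>(A)\<close> is the ideal generated by \<open>A\<close>.\<close>

definition smult_span :: "('r, 'a) ring_scheme \<Rightarrow> ('r, 'm, 'b) module_scheme \<Rightarrow> 'r set \<Rightarrow> 'm set" where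
  "smult_span R M A =
     \<Inter>{N. submodule N R M \<and> (\<forall>a \<in> A. \<forall>v \<in> carrier M. a \<odot>\<^bsub>M\<^esub> v \<in> N)}"

text \<open>
  The first condition says that \<open>xs ! i\<close> is a nonzerodivisor on \<open>M / (xs ! 0, \<dots>, xs ! (i - 1)) M\<close>;
  the second that \<open>M / (xs) M\<close> is nonzero.
\<close>

definition regular_sequence :: "('r, 'a) ring_scheme \<Rightarrow> ('r, 'm, 'b) module_scheme \<Rightarrow> 'r list \<Rightarrow> bool" where
  "regular_sequence R M xs \<longleftrightarrow>
     set xs \<subseteq> carrier R \<and>
     (\<forall>i < length xs. \<forall>v \<in> carrier M.
        (xs ! i) \<odot>\<^bsub>M\<^esub> v \<in> smult_span R M (set (take i xs)) \<longrightarrow>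
        v \<in> smult_span R M (set (take i xs))) \<and>
     smult_span R M (set xs) \<noteq> carrier M"

text \<open>
  The supremum of the lengths of the \<open>M\<close>-regular sequences in the ideal \<open>J\<close>.
  For \<open>M = 0\<close> there is no regular sequence and the value is \<open>0\<close>, not \<open>\<infinity>\<close>.
\<close>

definition depth :: "('r, 'a) ring_scheme \<Rightarrow> 'r set \<Rightarrow> ('r, 'm, 'b) module_scheme \<Rightarrow> enat" where
  "depth R J M = Sup {enat (length xs) | xs. set xs \<subseteq> J \<and> regular_sequence R M xs}"

section \<open>Graphs and edge ideals\<close>

text \<open>
  A finite simple graph is a finite, loop-free, symmetric digraph without parallel arcs
  (\<^locale>\<open>pair_graph\<close>): an edge is represented by its two orientations.
\<close>

definition edge_ideal :: "'v pair_pre_digraph \<Rightarrow> (('v \<Rightarrow>\<^sub>0 nat) \<Rightarrow>\<^sub>0 'k::field) set" where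
  "edge_ideal G = genideal (polynomial_ring (pverts G)) {var u * var v | u v. (u, v) \<in> parcs G}"

definition path_graph :: "nat \<Rightarrow> nat pair_pre_digraph" where
  "path_graph m =
     \<lparr>pverts = {1..m},
      parcs = {(i, j). i \<in> {1..m} \<and> j \<in> {1..m} \<and> (j = i + 1 \<or> i = j + 1)}\<rparr>"

text \<open>The cycle graph is only meaningful for \<open>n \<ge> 3\<close>.\<close>

definition cycle_graph :: "nat \<Rightarrow> nat pair_pre_digraph" where
  "cycle_graph n =
     \<lparr>pverts = {1..n},
      parcs = {(i, j). i \<in> {1..n} \<and> j \<in> {1..n} \<and>
                 (j = i + 1 \<or> i = j + 1 \<or> (i = 1 \<and> j = n) \<or> (i = n \<and> j = 1))}\<rparr>"

definition strong_product ::
    "'a pair_pre_digraph \<Rightarrow> 'b pair_pre_digraph \<Rightarrow> ('a \<times> 'b) pair_pre_digraph" where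
  "strong_product G H =
     \<lparr>pverts = pverts G \<times> pverts H,
      parcs = {((v1, u1), (v2, u2)).
                 (v1, u1) \<in> pverts G \<times> pverts H \<and> (v2, u2) \<in> pverts G \<times> pverts H \<and>
                 (v1, u1) \<noteq> (v2, u2) \<and>
                 (v1 = v2 \<or> (v1, v2) \<in> parcs G) \<and> (u1 = u2 \<or> (u1, u2) \<in> parcs H)}\<rparr>"

definition cycle_path_graph :: "nat \<Rightarrow> nat \<Rightarrow> (nat \<times> nat) pair_pre_digraph" where
  "cycle_path_graph n m = strong_product (cycle_graph n) (path_graph m)"

lemma pair_graph_cycle_path_graph:
  assumes "n \<ge> 3"
  shows "pair_graph (cycle_path_graph n m)"
proof -
  let ?G = "cycle_path_graph n m"
  have fin: "finite (pverts ?G)"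
    by (simp add: cycle_path_graph_def strong_product_def cycle_graph_def path_graph_def)
  moreover have sub: "parcs ?G \<subseteq> pverts ?G \<times> pverts ?G"
    by (auto simp: cycle_path_graph_def strong_product_def)
  ultimately have "finite (parcs ?G)"
    by (meson finite_SigmaI finite_subset)
  moreover have "symmetric ?G"
    by (auto simp: symmetric_def sym_def cycle_path_graph_def strong_product_def
          cycle_graph_def path_graph_def)
  ultimately show ?thesis
    using fin sub
    by unfold_locales (auto simp: cycle_path_graph_def strong_product_def)
qed

lemma cycle_path_graph_adjacent_iff:
  assumes "n \<ge> 3" "i \<in> {1..n}" "k \<in> {1..n}" "j \<in> {1..m}" "l \<in> {1..m}"
  shows "((i, j), (k, l)) \<in> parcs (cycle_path_graph n m) \<longleftrightarrow>
           (i, j) \<noteq> (k, l) \<and>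
           (\<exists>d \<in> {-1, 0, 1}. (int i - int k) mod int n = d mod int n) \<and>
           \<bar>int j - int l\<bar> \<le> 1"
proof -
  have 1: "(i = k \<or> (i, k) \<in> parcs (cycle_graph n)) \<longleftrightarrow>
      (\<exists>d \<in> {-1, 0, 1}. (int i - int k) mod int n = d mod int n)"
  proof -
    have mod_iff: "(int i - int k) mod int n = d mod int n \<longleftrightarrow>
        int i - int k = d \<or> int i - int k = d + int n \<or> int i - int k = d - int n"
      if d: "d \<in> {-1, 0, 1}" for d
    proof
      assume "(int i - int k) mod int n = d mod int n"
      then obtain q where q: "int i - int k - d = int n * q"
        by (metis mod_eq_dvd_iff dvdE)
      have "\<bar>int n * q\<bar> \<le> int n"
        using assms d by (auto simp: q[symmetric])
      then have "\<bar>q\<bar> \<le> 1"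
        using assms by (simp add: abs_mult)
      then have "q = -1 \<or> q = 0 \<or> q = 1" by linarith
      with q show "int i - int k = d \<or> int i - int k = d + int n \<or> int i - int k = d - int n"
        by auto
    next
      assume "int i - int k = d \<or> int i - int k = d + int n \<or> int i - int k = d - int n"
      then show "(int i - int k) mod int n = d mod int n"
        by (metis mod_add_self2 minus_mod_self2)
    qed
    have "(i = k \<or> (i, k) \<in> parcs (cycle_graph n)) \<longleftrightarrow>
        i = k \<or> k = i + 1 \<or> i = k + 1 \<or> (i = 1 \<and> k = n) \<or> (i = n \<and> k = 1)"
      using assms by (simp add: cycle_graph_def)
    also have "\<dots> \<longleftrightarrow> int i - int k \<in> {0, -1, 1, 1 - int n, int n - 1}"
      using assms by auto
    also have "\<dots> \<longleftrightarrow> (\<exists>d \<in> {-1, 0, 1}. int i - int k = d \<or> int i - int k = d + int n \<or>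
        int i - int k = d - int n)"
      using assms by auto
    also have "\<dots> \<longleftrightarrow> (\<exists>d \<in> {-1, 0, 1}. (int i - int k) mod int n = d mod int n)"
      by (intro bex_cong refl) (simp only: mod_iff)
    finally show ?thesis .
  qed
  have 2: "(j = l \<or> (j, l) \<in> parcs (path_graph m)) \<longleftrightarrow> \<bar>int j - int l\<bar> \<le> 1"
    using assms by (auto simp: path_graph_def)
  have "i \<in> pverts (cycle_graph n)" "k \<in> pverts (cycle_graph n)"
    "j \<in> pverts (path_graph m)" "l \<in> pverts (path_graph m)"
    using assms by (simp_all add: cycle_graph_def path_graph_def)
  then have "((i, j), (k, l)) \<in> parcs (cycle_path_graph n m) \<longleftrightarrow>
      (i, j) \<noteq> (k, l) \<and> (i = k \<or> (i, k) \<in> parcs (cycle_graph n)) \<and>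
      (j = l \<or> (j, l) \<in> parcs (path_graph m))"
    by (simp add: cycle_path_graph_def strong_product_def)
  then show ?thesis
    unfolding 1 2 .
qed

end

theory Submission
  imports Defs
begin

text \<open>
  The bound comes from a nonzero cohomology class. Write \<open>S\<close> for the polynomial ring and \<open>I\<close> for
  the edge ideal, and choose elements \<open>z\<^sub>v\<close>, one for each variable \<open>x\<^sub>v\<close>, with \<open>z\<^sub>v\<close> dividing
  \<open>x\<^sub>v\<^sup>2\<close>. As in Koszul cohomology, if \<open>y\<close> lies in the graded maximal ideal and is a nonzerodivisor on
  \<open>S/I\<close>, then a nonzero class of degree \<open>d\<close> over \<open>S/I\<close> yields one of degree \<open>d - 1\<close> over
  \<open>S/(I + yS)\<close>: after multiplication by a suitable polynomial the class is killed by all variables,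
  hence by \<open>y\<close>, and a cochain that bounds \<open>y\<close> times the class is a nonzero class modulo \<open>y\<close>. No
  cohomology lives in negative degrees, so a regular sequence has length at most \<open>d\<close>
  (\<open>regular_length_le\<close>, \<open>depth_quotient_le\<close>).

  It remains to produce classes of low degree. A maximal independent set \<open>A\<close> of a graph gives a class
  of degree \<open>|A|\<close>, represented by the exterior product of the cochains \<open>x\<^sub>a e\<^sub>a\<close>, where \<open>e\<^sub>a\<close> is the
  indicator of \<open>a\<close>. This is not enough for a cycle of length \<open>3k + 1\<close>: its maximal independent sets
  have more than \<open>k\<close> vertices, while its independence complex is homotopy equivalent to a sphere of
  dimension \<open>k - 1\<close>. The cocycle that detects this sphere is the
  product \<open>\<phi>\<^sub>1 \<and> \<dots> \<and> \<phi>\<^sub>k\<close> with \<open>\<phi>\<^sub>i = \<Sum>\<^sub>u x\<^sub>u e\<^sub>u\<close>, the sum being over a set \<open>U\<^sub>i\<close> of vertices. The sets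
  \<open>U\<^sub>i\<close> are disjoint, and the product is a cocycle as soon as no independent set meets every one of
  \<open>U\<^sub>1, \<dots>, U\<^sub>k\<close> and the complement of their union. The class is nonzero because it pairs nontrivially with a
  cross-polytope \<open>{a\<^sub>1, b\<^sub>1} * \<dots> * {a\<^sub>k, b\<^sub>k}\<close> in the independence complex, where \<open>a\<^sub>i \<in> U\<^sub>i\<close> and \<open>b\<^sub>i\<close> lies in
  the complement of the union. Theorem \<open>depth_edge_ideal_le\<close> states this criterion, with some of the \<open>U\<^sub>i\<close>
  allowed to be single vertices without a partner, which covers maximal independent sets as well.

  For the strong product of \<open>C\<^sub>n\<close> and \<open>P\<^sub>m\<close> the path is cut into \<open>\<lceil>m/3\<rceil>\<close> blocks of at most three
  rows. Each block is dominated by a copy, in one of its rows, of a dominating independent set of \<open>C\<^sub>n\<close>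
  of size \<open>\<lceil>n/3\<rceil>\<close>. If \<open>n \<equiv> 1\<close> modulo 3 and \<open>m\<close> is not a multiple of 3, one block of one or two rows
  uses the sphere above instead, which saves one; in all other cases \<open>\<lceil>m/3\<rceil> * \<lceil>n/3\<rceil>\<close> is already the
  desired bound.
\<close>

section \<open>Cochains on words and exterior multiplication\<close>

text \<open>
  Exterior multiplication of a cochain by a linear form. Cochains are functions on all words over the
  vertex set rather than alternating functions on subsets; unfolded, the value at \<open>v\<^sub>0 \<dots> v\<^sub>j\<close> is the
  alternating sum of \<open>\<phi> v\<^sub>i\<close> times \<open>c\<close> at the word without its letter \<open>v\<^sub>i\<close>. In this form the signs
  are produced by the recursion and no order on the vertices enters. On alternating
  functions and with \<open>\<phi> = z\<close> it is the differential of the Koszul complex.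
\<close>

primrec wedge :: "('v \<Rightarrow> 'a::comm_ring_1) \<Rightarrow> ('v list \<Rightarrow> 'a) \<Rightarrow> 'v list \<Rightarrow> 'a" where
  "wedge \<phi> c [] = 0"
| "wedge \<phi> c (v # l) = \<phi> v * c l - wedge \<phi> (\<lambda>l. c (v # l)) l"

lemma wedge_diff: "wedge \<phi> (\<lambda>l. c l - c' l) l = wedge \<phi> c l - wedge \<phi> c' l"
  by (induction l arbitrary: c c') (simp_all add: algebra_simps)

lemma wedge_add: "wedge \<phi> (\<lambda>l. c l + c' l) l = wedge \<phi> c l + wedge \<phi> c' l"
  by (induction l arbitrary: c c') (simp_all add: algebra_simps)

lemma wedge_scale: "wedge \<phi> (\<lambda>l. a * c l) l = a * wedge \<phi> c l"
  by (induction l arbitrary: c) (simp_all add: algebra_simps)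

lemma wedge_zero: "wedge \<phi> (\<lambda>l. 0) l = 0"
  by (induction l) simp_all

lemma wedge_sum: "wedge \<phi> (\<lambda>l. \<Sum>i\<in>A. c i l) l = (\<Sum>i\<in>A. wedge \<phi> (c i) l)"
  by (induction A rule: infinite_finite_induct) (simp_all add: wedge_zero wedge_add)

lemma wedge_form_add: "wedge (\<lambda>v. \<phi> v + \<psi> v) c l = wedge \<phi> c l + wedge \<psi> c l"
  by (induction l arbitrary: c) (simp_all add: algebra_simps)

lemma wedge_form_scale: "wedge (\<lambda>v. a * \<phi> v) c l = a * wedge \<phi> c l"
  by (induction l arbitrary: c) (simp_all add: algebra_simps)

lemma wedge_form_zero: "wedge (\<lambda>v. 0) c l = 0"
  by (induction l arbitrary: c) simp_all

lemma wedge_form_sum: "wedge (\<lambda>v. \<Sum>i\<in>A. \<phi> i v) c l = (\<Sum>i\<in>A. wedge (\<phi> i) c l)"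
  by (induction A rule: infinite_finite_induct)
    (simp_all add: wedge_form_zero wedge_form_add)

lemma wedge_cong:
  assumes "\<And>v. v \<in> set l \<Longrightarrow> \<phi> v = \<psi> v"
    and "\<And>l'. set l' \<subseteq> set l \<Longrightarrow> Suc (length l') = length l \<Longrightarrow> c l' = c' l'"
  shows "wedge \<phi> c l = wedge \<psi> c' l"
  using assms
proof (induction l arbitrary: c c')
  case (Cons v l)
  have "wedge \<phi> (\<lambda>l. c (v # l)) l = wedge \<psi> (\<lambda>l. c' (v # l)) l"
    by (rule Cons.IH) (auto intro!: Cons.prems)
  moreover have "\<phi> v * c l = \<psi> v * c' l"
    using Cons.prems(1)[of v] Cons.prems(2)[of l] by (simp add: subset_insertI)
  ultimately show ?case by simp
qed simp

lemma wedge_wedge_self: "wedge \<phi> (wedge \<phi> c) l = 0"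
  by (induction l arbitrary: c) (simp_all add: wedge_diff wedge_scale)

lemma wedge_anticommute: "wedge \<phi> (wedge \<psi> c) l = - wedge \<psi> (wedge \<phi> c) l"
  by (induction l arbitrary: c) (simp_all add: wedge_diff wedge_scale)

text \<open>
  Contraction is dual to exterior multiplication: the two satisfy the Cartan formula, which is
  \<open>contract_wedge\<close> below. It makes multiplication by the pairing of \<open>\<xi>\<close> and \<open>z\<close> null-homotopic, and
  serves to evaluate a product of forms by successive contractions.
\<close>

definition contract :: "'v set \<Rightarrow> ('v \<Rightarrow> 'a::comm_ring_1) \<Rightarrow> ('v list \<Rightarrow> 'a) \<Rightarrow> 'v list \<Rightarrow> 'a" where
  "contract V \<xi> c l = (\<Sum>v\<in>V. \<xi> v * c (v # l))"

lemma contract_wedge: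
  "contract V \<xi> (wedge \<phi> c) l = (\<Sum>v\<in>V. \<xi> v * \<phi> v) * c l - wedge \<phi> (contract V \<xi> c) l"
proof -
  have "wedge \<phi> (contract V \<xi> c) l = (\<Sum>v\<in>V. \<xi> v * wedge \<phi> (\<lambda>l. c (v # l)) l)"
    unfolding contract_def[abs_def] by (simp add: wedge_sum wedge_scale)
  then show ?thesis
    by (simp add: contract_def sum_distrib_right right_diff_distrib sum_subtractf mult.assoc)
qed

definition wedge_prod :: "('v \<Rightarrow> 'a::comm_ring_1) list \<Rightarrow> 'v list \<Rightarrow> 'a" where
  "wedge_prod \<phi>s = foldr wedge \<phi>s (\<lambda>l. if l = [] then 1 else 0)"

lemma wedge_prod_simps:
  "wedge_prod [] = (\<lambda>l. if l = [] then 1 else 0)"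
  "wedge_prod (\<phi> # \<phi>s) = wedge \<phi> (wedge_prod \<phi>s)"
  by (simp_all add: wedge_prod_def)

text \<open>
  Linear forms anticommute, so the new factor can be moved next to its copy, where it squares to zero.
\<close>

lemma wedge_wedge_prod_eq_0:
  assumes "\<phi> \<in> set \<phi>s"
  shows "wedge \<phi> (wedge_prod \<phi>s) l = 0"
  using assms
proof (induction \<phi>s arbitrary: l)
  case (Cons \<psi> \<phi>s)
  show ?case
  proof (cases "\<phi> = \<psi>")
    case True
    then show ?thesis by (simp add: wedge_prod_simps wedge_wedge_self)
  next
    case False
    then have "wedge \<phi> (wedge_prod \<phi>s) = (\<lambda>l. 0)"
      using Cons by auto
    then show ?thesis
      by (simp add: wedge_prod_simps wedge_anticommute[of \<phi>] wedge_zero)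
  qed
qed simp

lemma contract_wedge_prod_eq_0:
  assumes "\<And>\<phi>. \<phi> \<in> set \<phi>s \<Longrightarrow> (\<Sum>v\<in>V. \<xi> v * \<phi> v) = 0"
  shows "contract V \<xi> (wedge_prod \<phi>s) l = 0"
  using assms
proof (induction \<phi>s arbitrary: l)
  case Nil
  then show ?case by (simp add: wedge_prod_simps contract_def)
next
  case (Cons \<phi> \<phi>s)
  then have "contract V \<xi> (wedge_prod \<phi>s) = (\<lambda>l. 0)"
    by auto
  with Cons.prems show ?case
    by (simp add: wedge_prod_simps contract_wedge wedge_zero)
qed

definition contract_list ::
    "'v set \<Rightarrow> ('v \<Rightarrow> 'a::comm_ring_1) list \<Rightarrow> ('v list \<Rightarrow> 'a) \<Rightarrow> 'v list \<Rightarrow> 'a" where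
  "contract_list V \<xi>s c = fold (contract V) \<xi>s c"

lemma contract_list_simps:
  "contract_list V [] c = c"
  "contract_list V (\<xi> # \<xi>s) c = contract_list V \<xi>s (contract V \<xi> c)"
  by (simp_all add: contract_list_def)

lemma contract_list_scale: "contract_list V \<xi>s (\<lambda>l. a * c l) = (\<lambda>l. a * contract_list V \<xi>s c l)"
proof (induction \<xi>s arbitrary: c)
  case (Cons \<xi> \<xi>s)
  have "contract V \<xi> (\<lambda>l. a * c l) = (\<lambda>l. a * contract V \<xi> c l)"
    by (auto simp: contract_def sum_distrib_left algebra_simps)
  with Cons show ?case by (simp add: contract_list_simps)
qed (simp add: contract_list_simps)

lemma contract_list_diff:
  "contract_list V \<xi>s (\<lambda>l. c l - c' l) = (\<lambda>l. contract_list V \<xi>s c l - contract_list V \<xi>s c' l)"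
proof (induction \<xi>s arbitrary: c c')
  case (Cons \<xi> \<xi>s)
  have "contract V \<xi> (\<lambda>l. c l - c' l) = (\<lambda>l. contract V \<xi> c l - contract V \<xi> c' l)"
    by (auto simp: contract_def sum_subtractf algebra_simps)
  with Cons show ?case by (simp add: contract_list_simps)
qed (simp add: contract_list_simps)

text \<open>
  This is the determinant of the matrix of pairings of the \<open>\<xi> a\<close> with the \<open>\<phi> a'\<close>, in the case of a
  diagonal matrix. Contracting in the order of the factors makes each surviving term the first one, so
  no sign appears.
\<close>

lemma contract_list_wedge_prod:
  assumes "distinct as"
    and "\<And>a a'. a \<in> set as \<Longrightarrow> a' \<in> set as \<Longrightarrow>
      (\<Sum>v\<in>V. \<xi> a v * \<phi> a' v) = (if a = a' then x a else 0)"
  shows "contract_list V (map \<xi> as) (wedge_prod (map \<phi> as)) [] = prod_list (map x as)"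
  using assms
proof (induction as)
  case Nil
  then show ?case by (simp add: contract_list_simps wedge_prod_simps)
next
  case (Cons a as)
  have "contract V (\<xi> a) (wedge_prod (map \<phi> as)) = (\<lambda>l. 0)"
  proof
    fix l
    show "contract V (\<xi> a) (wedge_prod (map \<phi> as)) l = 0"
    proof (rule contract_wedge_prod_eq_0)
      fix f assume "f \<in> set (map \<phi> as)"
      then obtain a' where "a' \<in> set as" "f = \<phi> a'" by auto
      with Cons.prems show "(\<Sum>v\<in>V. \<xi> a v * f v) = 0" by auto
    qed
  qed
  moreover have "(\<Sum>v\<in>V. \<xi> a v * \<phi> a v) = x a"
    using Cons.prems(2)[of a a] by simp
  ultimately have "contract V (\<xi> a) (wedge_prod (map \<phi> (a # as))) =
      (\<lambda>l. x a * wedge_prod (map \<phi> as) l)"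
    by (auto simp: wedge_prod_simps contract_wedge wedge_zero)
  then show ?case
    using Cons by (simp add: contract_list_simps contract_list_scale)
qed

section \<open>Koszul cohomology bounds the length of regular sequences\<close>

text \<open>
  The coefficients are a subring of a ring type, and ideals are taken relative to the subring. Thus the
  polynomials in the variables of \<open>V\<close> can be computed with inside the type of all polynomials.
\<close>

locale subring =
  fixes S :: "'a::comm_ring_1 set"
  assumes zero_closed: "0 \<in> S" and one_closed: "1 \<in> S"
    and add_closed: "a \<in> S \<Longrightarrow> b \<in> S \<Longrightarrow> a + b \<in> S"
    and uminus_closed: "a \<in> S \<Longrightarrow> - a \<in> S"
    and mult_closed: "a \<in> S \<Longrightarrow> b \<in> S \<Longrightarrow> a * b \<in> S"
begin

definition ideal_of :: "'a set \<Rightarrow> bool" where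
  "ideal_of I \<longleftrightarrow> I \<subseteq> S \<and> 0 \<in> I \<and> (\<forall>a\<in>I. \<forall>b\<in>I. a + b \<in> I) \<and> (\<forall>r\<in>S. \<forall>a\<in>I. r * a \<in> I)"

lemma ideal_of_S: "ideal_of S"
  using zero_closed add_closed mult_closed by (auto simp: ideal_of_def)

lemma ideal_ofD:
  assumes "ideal_of I"
  shows "a \<in> I \<Longrightarrow> a \<in> S" "0 \<in> I" "a \<in> I \<Longrightarrow> b \<in> I \<Longrightarrow> a + b \<in> I"
    "r \<in> S \<Longrightarrow> a \<in> I \<Longrightarrow> r * a \<in> I" "a \<in> I \<Longrightarrow> r \<in> S \<Longrightarrow> a * r \<in> I"
  using assms by (auto simp: ideal_of_def mult.commute)

lemma ideal_of_diff:
  assumes "ideal_of I" "a \<in> I" "b \<in> I"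
  shows "a - b \<in> I"
proof -
  have "(-1) * b \<in> I"
    using assms one_closed uminus_closed by (blast intro: ideal_ofD)
  then show ?thesis
    using ideal_ofD(3)[OF assms(1,2), of "(-1) * b"] by simp
qed

lemma ideal_of_sum:
  assumes "ideal_of I" "\<And>i. i \<in> A \<Longrightarrow> f i \<in> I"
  shows "sum f A \<in> I"
  using assms(2)
  by (induction A rule: infinite_finite_induct) (auto intro: ideal_ofD[OF assms(1)])

lemma diff_closed: "a \<in> S \<Longrightarrow> b \<in> S \<Longrightarrow> a - b \<in> S"
  using ideal_of_diff[OF ideal_of_S] .

lemma wedge_in_ideal:
  assumes I: "ideal_of I" and l: "set l \<subseteq> V"
    and "\<And>v l'. v \<in> V \<Longrightarrow> set l' \<subseteq> V \<Longrightarrow> Suc (length l') = length l \<Longrightarrow> \<phi> v * c l' \<in> I"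
  shows "wedge \<phi> c l \<in> I"
  using l assms(3)
proof (induction l arbitrary: c)
  case Nil
  then show ?case by (simp add: ideal_ofD(2)[OF I])
next
  case (Cons v l)
  have "wedge \<phi> (\<lambda>l. c (v # l)) l \<in> I"
    by (rule Cons.IH) (use Cons.prems in auto)
  moreover have "\<phi> v * c l \<in> I"
    by (rule Cons.prems(2)) (use Cons.prems(1) in auto)
  ultimately show ?case
    by (simp add: ideal_of_diff[OF I])
qed

lemma wedge_closed:
  assumes "set l \<subseteq> V" "\<And>v. v \<in> V \<Longrightarrow> \<phi> v \<in> S" "\<And>l. set l \<subseteq> V \<Longrightarrow> c l \<in> S"
  shows "wedge \<phi> c l \<in> S"
  by (rule wedge_in_ideal[OF ideal_of_S assms(1)]) (auto intro: mult_closed assms)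

lemma wedge_prod_closed:
  assumes "set l \<subseteq> V" "\<And>\<phi> v. \<phi> \<in> set \<phi>s \<Longrightarrow> v \<in> V \<Longrightarrow> \<phi> v \<in> S"
  shows "wedge_prod \<phi>s l \<in> S"
  using assms
proof (induction \<phi>s arbitrary: l)
  case (Cons \<phi> \<phi>s)
  show ?case
    unfolding wedge_prod_simps
  proof (rule wedge_closed[OF Cons.prems(1)])
    show "wedge_prod \<phi>s l' \<in> S" if "set l' \<subseteq> V" for l'
      using Cons.IH[OF that] Cons.prems(2) by simp
  qed (simp add: Cons.prems(2))
qed (auto simp: wedge_prod_simps zero_closed one_closed)

text \<open>
  A value of the product is a signed sum of products \<open>\<phi> a\<^sub>1 v\<^sub>1 \<dots> \<phi> a\<^sub>d v\<^sub>d\<close>. The factor \<open>r\<close> collects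
  those that have already been split off in the induction.
\<close>

lemma wedge_prod_in_ideal:
  assumes I: "ideal_of I" and "distinct as" "set l \<subseteq> V"
    and "\<And>u. (\<And>a. a \<in> set as \<Longrightarrow> u a \<in> V) \<Longrightarrow> r * (\<Prod>a\<in>set as. \<phi> a (u a)) \<in> I"
  shows "r * wedge_prod (map \<phi> as) l \<in> I"
  using assms(2-)
proof (induction as arbitrary: r l)
  case Nil
  then show ?case
    by (auto simp: wedge_prod_simps ideal_ofD(2)[OF I])
next
  case (Cons a as)
  have "wedge (\<phi> a) (\<lambda>l. r * wedge_prod (map \<phi> as) l) l \<in> I"
  proof (rule wedge_in_ideal[OF I Cons.prems(2)])
    fix v l' assume v: "v \<in> V" and l': "set l' \<subseteq> V"
    have "(r * \<phi> a v) * wedge_prod (map \<phi> as) l' \<in> I"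
    proof (rule Cons.IH[OF _ l'])
      fix u assume u: "\<And>a. a \<in> set as \<Longrightarrow> u a \<in> V"
      have "r * (\<Prod>a'\<in>set (a # as). \<phi> a' ((u(a := v)) a')) \<in> I"
        by (rule Cons.prems(3)) (use u v in auto)
      moreover have "(\<Prod>a'\<in>set as. \<phi> a' ((u(a := v)) a')) = (\<Prod>a'\<in>set as. \<phi> a' (u a'))"
        using Cons.prems(1) by (intro prod.cong) auto
      ultimately show "r * \<phi> a v * (\<Prod>a\<in>set as. \<phi> a (u a)) \<in> I"
        using Cons.prems(1) by (simp add: mult.assoc)
    qed (use Cons.prems in auto)
    then show "\<phi> a v * (r * wedge_prod (map \<phi> as) l') \<in> I"
      by (simp add: ac_simps)
  qed
  then show ?case
    by (simp add: wedge_prod_simps wedge_scale)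
qed

lemma contract_list_in_ideal:
  assumes I: "ideal_of I" and "\<And>\<xi> v. \<xi> \<in> set \<xi>s \<Longrightarrow> v \<in> V \<Longrightarrow> \<xi> v \<in> S"
    and "\<And>l. set l \<subseteq> V \<Longrightarrow> length l = length \<xi>s + k \<Longrightarrow> c l \<in> I"
    and "set l \<subseteq> V" "length l = k"
  shows "contract_list V \<xi>s c l \<in> I"
  using assms(2-)
proof (induction \<xi>s arbitrary: c)
  case (Cons \<xi> \<xi>s)
  have "contract V \<xi> c l' \<in> I" if "set l' \<subseteq> V" "length l' = length \<xi>s + k" for l'
    unfolding contract_def
    by (rule ideal_of_sum[OF I]) (rule ideal_ofD(4)[OF I], use Cons.prems that in auto)
  with Cons show ?case
    by (simp add: contract_list_simps)
qed (simp add: contract_list_simps)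

text \<open>
  Full contraction sends coboundaries into every ideal that contains the pairings of the \<open>\<xi>\<close> with \<open>z\<close>:
  by the Cartan formula each contraction passes the differential at the cost of such a pairing, and on
  the empty word the differential vanishes. This is how cocycles are shown not to be coboundaries.
\<close>

lemma contract_list_wedge_in_ideal:
  assumes I: "ideal_of I" and "\<And>\<xi> v. \<xi> \<in> set \<xi>s \<Longrightarrow> v \<in> V \<Longrightarrow> \<xi> v \<in> S"
    and "\<And>\<xi>. \<xi> \<in> set \<xi>s \<Longrightarrow> (\<Sum>v\<in>V. \<xi> v * z v) \<in> I"
    and "\<And>l. set l \<subseteq> V \<Longrightarrow> c l \<in> S"
  shows "contract_list V \<xi>s (wedge z c) [] \<in> I"
  using assms(2-)
proof (induction \<xi>s arbitrary: c)
  case Nil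
  then show ?case by (simp add: contract_list_simps ideal_ofD(2)[OF I])
next
  case (Cons \<xi> \<xi>s)
  have "contract_list V \<xi>s (wedge z (contract V \<xi> c)) [] \<in> I"
  proof (rule Cons.IH)
    show "contract V \<xi> c l \<in> S" if "set l \<subseteq> V" for l
      unfolding contract_def
      by (rule ideal_of_sum[OF ideal_of_S]) (rule mult_closed, use Cons.prems that in auto)
  qed (use Cons.prems in auto)
  moreover have "contract_list V \<xi>s c [] \<in> S"
    by (rule contract_list_in_ideal[OF ideal_of_S]) (use Cons.prems in auto)
  ultimately have "(\<Sum>v\<in>V. \<xi> v * z v) * contract_list V \<xi>s c [] -
      contract_list V \<xi>s (wedge z (contract V \<xi> c)) [] \<in> I"
    using Cons.prems(2)[of \<xi>] by (intro ideal_of_diff[OF I] ideal_ofD(5)[OF I]) auto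
  moreover have "contract V \<xi> (wedge z c) =
      (\<lambda>l. (\<Sum>v\<in>V. \<xi> v * z v) * c l - wedge z (contract V \<xi> c) l)"
    by (rule ext) (rule contract_wedge)
  ultimately show ?case
    by (simp add: contract_list_simps contract_list_diff contract_list_scale)
qed

text \<open>
  One function holds cochains of all degrees; its part of degree \<open>j\<close> is the restriction to words of
  length \<open>j\<close>, and only this part is tested for being closed or exact modulo \<open>I\<close>.
\<close>

definition cocycle :: "'v set \<Rightarrow> ('v \<Rightarrow> 'a) \<Rightarrow> 'a set \<Rightarrow> nat \<Rightarrow> ('v list \<Rightarrow> 'a) \<Rightarrow> bool" where
  "cocycle V z I j c \<longleftrightarrow> (\<forall>l. set l \<subseteq> V \<longrightarrow> c l \<in> S) \<and>
     (\<forall>l. set l \<subseteq> V \<longrightarrow> length l = Suc j \<longrightarrow> wedge z c l \<in> I)"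

definition coboundary :: "'v set \<Rightarrow> ('v \<Rightarrow> 'a) \<Rightarrow> 'a set \<Rightarrow> nat \<Rightarrow> ('v list \<Rightarrow> 'a) \<Rightarrow> bool" where
  "coboundary V z I j c \<longleftrightarrow> (\<exists>b. (\<forall>l. set l \<subseteq> V \<longrightarrow> b l \<in> S) \<and>
     (\<forall>l. set l \<subseteq> V \<longrightarrow> length l = j \<longrightarrow> c l - wedge z b l \<in> I))"

definition nonzero_cohomology :: "'v set \<Rightarrow> ('v \<Rightarrow> 'a) \<Rightarrow> 'a set \<Rightarrow> nat \<Rightarrow> bool" where
  "nonzero_cohomology V z I j \<longleftrightarrow> (\<exists>c. cocycle V z I j c \<and> \<not> coboundary V z I j c)"

lemma cocycle_scale:
  assumes "ideal_of I" "a \<in> S" "cocycle V z I j c"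
  shows "cocycle V z I j (\<lambda>l. a * c l)"
  using assms by (auto simp: cocycle_def wedge_scale intro: mult_closed ideal_ofD)

lemma coboundary_zero:
  assumes "ideal_of I"
  shows "coboundary V z I j (\<lambda>l. 0)"
  unfolding coboundary_def
  by (rule exI[of _ "\<lambda>l. 0"]) (simp add: wedge_zero zero_closed ideal_ofD(2)[OF assms])

lemma coboundary_add:
  assumes I: "ideal_of I" and "coboundary V z I j c" "coboundary V z I j c'"
  shows "coboundary V z I j (\<lambda>l. c l + c' l)"
proof -
  obtain b b' where
    b: "\<And>l. set l \<subseteq> V \<Longrightarrow> b l \<in> S" "\<And>l. set l \<subseteq> V \<Longrightarrow> length l = j \<Longrightarrow> c l - wedge z b l \<in> I"
    and b': "\<And>l. set l \<subseteq> V \<Longrightarrow> b' l \<in> S"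
      "\<And>l. set l \<subseteq> V \<Longrightarrow> length l = j \<Longrightarrow> c' l - wedge z b' l \<in> I"
    using assms unfolding coboundary_def by metis
  have "c l + c' l - wedge z (\<lambda>l. b l + b' l) l \<in> I" if "set l \<subseteq> V" "length l = j" for l
    using ideal_ofD(3)[OF I b(2)[OF that] b'(2)[OF that]] by (simp add: wedge_add algebra_simps)
  with b(1) b'(1) show ?thesis
    unfolding coboundary_def by (intro exI[of _ "\<lambda>l. b l + b' l"]) (auto intro: add_closed)
qed

lemma coboundary_scale:
  assumes I: "ideal_of I" and "a \<in> S" "coboundary V z I j c"
  shows "coboundary V z I j (\<lambda>l. a * c l)"
proof -
  obtain b where
    b: "\<And>l. set l \<subseteq> V \<Longrightarrow> b l \<in> S" "\<And>l. set l \<subseteq> V \<Longrightarrow> length l = j \<Longrightarrow> c l - wedge z b l \<in> I"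
    using assms unfolding coboundary_def by metis
  have "a * c l - wedge z (\<lambda>l. a * b l) l \<in> I" if "set l \<subseteq> V" "length l = j" for l
    using ideal_ofD(4)[OF I assms(2) b(2)[OF that]] by (simp add: wedge_scale algebra_simps)
  with b(1) assms(2) show ?thesis
    unfolding coboundary_def by (intro exI[of _ "\<lambda>l. a * b l"]) (auto intro: mult_closed)
qed

text \<open>
  Prefixing words with \<open>v\<close> is a homotopy from multiplication by \<open>z v\<close> to zero; with the chosen
  differential this is its defining equation.
\<close>

lemma coboundary_scale_form:
  assumes "cocycle V z I j c" "v \<in> V"
  shows "coboundary V z I j (\<lambda>l. z v * c l)"
  unfolding coboundary_def
proof (intro exI[of _ "\<lambda>l. c (v # l)"] conjI allI impI)
  fix l assume "set l \<subseteq> V" "length l = j"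
  then have "wedge z c (v # l) \<in> I"
    using assms unfolding cocycle_def by (metis insert_subset length_Cons list.simps(15))
  then show "z v * c l - wedge z (\<lambda>l. c (v # l)) l \<in> I"
    by simp
qed (use assms in \<open>auto simp: cocycle_def\<close>)

text \<open>
  The variables are treated one at a time: if \<open>x u\<close> does not kill the current class, the class is
  replaced by its multiple by \<open>x u\<close>, which \<open>x u\<close> kills, since \<open>x u * x u\<close> is a multiple of \<open>z u\<close>.
\<close>

lemma exists_multiple_killed:
  assumes I: "ideal_of I" and "finite U" "U \<subseteq> V" and x: "\<And>v. v \<in> V \<Longrightarrow> x v \<in> S"
    and xz: "\<And>v. v \<in> V \<Longrightarrow> \<exists>r\<in>S. x v * x v = r * z v"
    and c: "cocycle V z I j c" "\<not> coboundary V z I j c"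
  shows "\<exists>c'. cocycle V z I j c' \<and> \<not> coboundary V z I j c' \<and>
    (\<forall>v\<in>U. coboundary V z I j (\<lambda>l. x v * c' l))"
  using assms(2,3)
proof (induction U)
  case empty
  with c show ?case by blast
next
  case (insert u U)
  then obtain c' where c': "cocycle V z I j c'" "\<not> coboundary V z I j c'"
    "\<And>v. v \<in> U \<Longrightarrow> coboundary V z I j (\<lambda>l. x v * c' l)"
    by auto
  show ?case
  proof (cases "coboundary V z I j (\<lambda>l. x u * c' l)")
    case True
    with c' show ?thesis by blast
  next
    case False
    have u: "u \<in> V" using insert by auto
    have "coboundary V z I j (\<lambda>l. x v * (x u * c' l))" if "v \<in> insert u U" for v
    proof (cases "v = u")
      case True
      obtain r where r: "r \<in> S" "x u * x u = r * z u"
        using xz[OF u] by blast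
      have "coboundary V z I j (\<lambda>l. r * (z u * c' l))"
        by (intro coboundary_scale[OF I r(1)] coboundary_scale_form[OF c'(1) u])
      with r(2) show ?thesis
        by (simp add: True flip: mult.assoc)
    next
      case False
      with that have "coboundary V z I j (\<lambda>l. x u * (x v * c' l))"
        by (intro coboundary_scale[OF I x[OF u]] c'(3)) auto
      then show ?thesis by (simp add: ac_simps)
    qed
    with False cocycle_scale[OF I x[OF u] c'(1)] show ?thesis
      by (intro exI[of _ "\<lambda>l. x u * c' l"]) auto
  qed
qed

text \<open>
  A concrete form of the long exact sequence of multiplication by \<open>y\<close>. The class \<open>c\<close> is chosen so that
  \<open>y * c\<close> is the differential of some \<open>b\<close>. Then \<open>b\<close> is a cocycle modulo \<open>y\<close>; were it a coboundary
  \<open>wedge z e\<close> modulo \<open>y\<close>, say \<open>b = wedge z e + y * b'\<close>, then \<open>y * c = y * wedge z b'\<close>, and cancelling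
  \<open>y\<close> would make \<open>c\<close> a coboundary. In degree 0 nothing bounds \<open>y * c\<close> except zero, so \<open>c\<close> itself
  would vanish.
\<close>

lemma nonzero_cohomology_step:
  assumes I: "ideal_of I" and V: "finite V"
    and x: "\<And>v. v \<in> V \<Longrightarrow> x v \<in> S" and z: "\<And>v. v \<in> V \<Longrightarrow> z v \<in> S"
    and xz: "\<And>v. v \<in> V \<Longrightarrow> \<exists>r\<in>S. x v * x v = r * z v"
    and y: "y \<in> S" "\<And>T. ideal_of T \<Longrightarrow> x ` V \<subseteq> T \<Longrightarrow> y \<in> T"
    and reg: "\<And>a. a \<in> S \<Longrightarrow> y * a \<in> I \<Longrightarrow> a \<in> I"
    and H: "nonzero_cohomology V z I j"
  obtains i where "j = Suc i" "nonzero_cohomology V z {a + y * s | a s. a \<in> I \<and> s \<in> S} i"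
proof -
  define I' where "I' = {a + y * s | a s. a \<in> I \<and> s \<in> S}"
  obtain c where c: "cocycle V z I j c" "\<not> coboundary V z I j c"
    and cx: "\<And>v. v \<in> V \<Longrightarrow> coboundary V z I j (\<lambda>l. x v * c l)"
    using H exists_multiple_killed[OF I V subset_refl, of x z j] x xz
    unfolding nonzero_cohomology_def by blast
  have cS: "c l \<in> S" if "set l \<subseteq> V" for l
    using c that by (auto simp: cocycle_def)
  have "ideal_of {a \<in> S. coboundary V z I j (\<lambda>l. a * c l)}"
    unfolding ideal_of_def
    using coboundary_zero[OF I] coboundary_add[OF I, of V z j "\<lambda>l. _ * c l" "\<lambda>l. _ * c l"]
      coboundary_scale[OF I, of _ V z j "\<lambda>l. _ * c l"]
    by (auto intro: zero_closed add_closed mult_closed simp: distrib_right mult.assoc)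
  then have "y \<in> {a \<in> S. coboundary V z I j (\<lambda>l. a * c l)}"
    by (rule y(2)) (use x cx in auto)
  then obtain b where bS: "\<And>l. set l \<subseteq> V \<Longrightarrow> b l \<in> S"
    and b: "\<And>l. set l \<subseteq> V \<Longrightarrow> length l = j \<Longrightarrow> y * c l - wedge z b l \<in> I"
    unfolding coboundary_def by auto
  show ?thesis
  proof (cases j)
    case 0
    then have "y * c [] \<in> I"
      using b[of "[]"] by simp
    then have "c [] \<in> I"
      by (rule reg[rotated]) (simp add: cS)
    with 0 have "coboundary V z I j c"
      unfolding coboundary_def by (intro exI[of _ "\<lambda>l. 0"]) (simp add: zero_closed wedge_zero)
    with c show ?thesis by blast
  next
    case (Suc i)
    have "cocycle V z I' i b"
      unfolding cocycle_def
    proof (intro conjI allI impI)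
      fix l :: "'b list" assume l: "set l \<subseteq> V" "length l = Suc i"
      have "0 - (y * c l - wedge z b l) \<in> I"
        using b[OF l(1)] l(2) Suc by (blast intro: ideal_of_diff[OF I] ideal_ofD(2)[OF I])
      moreover have "wedge z b l = (0 - (y * c l - wedge z b l)) + y * c l"
        by simp
      ultimately show "wedge z b l \<in> I'"
        unfolding I'_def using cS[OF l(1)] by blast
    qed (use bS in auto)
    moreover have "\<not> coboundary V z I' i b"
    proof
      assume "coboundary V z I' i b"
      then obtain e where eS: "\<And>l. set l \<subseteq> V \<Longrightarrow> e l \<in> S"
        and e: "\<And>l. set l \<subseteq> V \<Longrightarrow> length l = i \<Longrightarrow> b l - wedge z e l \<in> I'"
        unfolding coboundary_def by auto
      have "\<exists>s. s \<in> S \<and> (length l = i \<longrightarrow> b l - wedge z e l - y * s \<in> I)" if "set l \<subseteq> V" for l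
        using e[OF that] zero_closed unfolding I'_def by (cases "length l = i") force+
      then obtain b' where b'S: "\<And>l. set l \<subseteq> V \<Longrightarrow> b' l \<in> S"
        and b': "\<And>l. set l \<subseteq> V \<Longrightarrow> length l = i \<Longrightarrow> b l - wedge z e l - y * b' l \<in> I"
        by metis
      have "coboundary V z I j c"
        unfolding coboundary_def
      proof (intro exI[of _ b'] conjI allI impI)
        fix l :: "'b list" assume l: "set l \<subseteq> V" "length l = j"
        have "wedge z (\<lambda>l. b l - wedge z e l - y * b' l) l \<in> I"
        proof (rule wedge_in_ideal[OF I l(1)])
          fix v l' assume "v \<in> V" "set l' \<subseteq> V" "Suc (length l') = length l"
          then show "z v * (b l' - wedge z e l' - y * b' l') \<in> I"
            using l Suc by (intro ideal_ofD(4)[OF I] z b') auto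
        qed
        then have "wedge z b l - y * wedge z b' l \<in> I"
          by (simp add: wedge_diff wedge_scale wedge_wedge_self)
        with b[OF l] have "y * c l - wedge z b l + (wedge z b l - y * wedge z b' l) \<in> I"
          by (rule ideal_ofD(3)[OF I])
        then have "y * (c l - wedge z b' l) \<in> I"
          by (simp add: algebra_simps)
        moreover have "wedge z b' l \<in> S"
          using wedge_closed[OF l(1) z b'S] by simp
        ultimately show "c l - wedge z b' l \<in> I"
          using reg cS[OF l(1)] diff_closed by blast
      qed (use b'S in auto)
      with c show False by blast
    qed
    ultimately show ?thesis
      using that Suc unfolding I'_def nonzero_cohomology_def by blast
  qed
qed

theorem regular_length_le:
  assumes I: "\<And>t. t \<le> r \<Longrightarrow> ideal_of (Is t)" and V: "finite V"
    and x: "\<And>v. v \<in> V \<Longrightarrow> x v \<in> S" and z: "\<And>v. v \<in> V \<Longrightarrow> z v \<in> S"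
    and xz: "\<And>v. v \<in> V \<Longrightarrow> \<exists>r\<in>S. x v * x v = r * z v"
    and y: "\<And>t. t < r \<Longrightarrow> y t \<in> S"
      "\<And>t T. t < r \<Longrightarrow> ideal_of T \<Longrightarrow> x ` V \<subseteq> T \<Longrightarrow> y t \<in> T"
    and reg: "\<And>t a. t < r \<Longrightarrow> a \<in> S \<Longrightarrow> y t * a \<in> Is t \<Longrightarrow> a \<in> Is t"
    and Suc: "\<And>t. t < r \<Longrightarrow> Is (Suc t) = {a + y t * s | a s. a \<in> Is t \<and> s \<in> S}"
    and H: "nonzero_cohomology V z (Is 0) j"
  shows "r \<le> j"
proof -
  have "t \<le> j \<and> nonzero_cohomology V z (Is t) (j - t)" if "t \<le> r" for t
    using that
  proof (induction t)
    case 0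
    with H show ?case by simp
  next
    case (Suc t)
    then have t: "t < r" and le: "t \<le> j" and H: "nonzero_cohomology V z (Is t) (j - t)"
      by auto
    obtain i where "j - t = Suc i" "nonzero_cohomology V z (Is (Suc t)) i"
      unfolding assms(9)[OF t]
    proof (rule nonzero_cohomology_step[OF I V x z xz y(1)[OF t] y(2)[OF t] reg[OF t] H])
      show "t \<le> r" using t by simp
    qed auto
    then have "Suc t \<le> j" "nonzero_cohomology V z (Is (Suc t)) (j - Suc t)"
      by (auto simp: diff_Suc)
    then show ?case ..
  qed
  from this[of r] show ?thesis by simp
qed

end

section \<open>Regular sequences on quotients of a polynomial ring\<close>

lemma polynomial_ring_simps [simp]:
  "zero (polynomial_ring V) = 0" "one (polynomial_ring V) = 1"
  "p \<oplus>\<^bsub>polynomial_ring V\<^esub> q = p + q" "p \<otimes>\<^bsub>polynomial_ring V\<^esub> q = p * q"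
  by (simp_all add: polynomial_ring_def)

lemma subring_polynomial_ring:
  "subring (carrier (polynomial_ring V :: (('v \<Rightarrow>\<^sub>0 nat) \<Rightarrow>\<^sub>0 'k::field) ring))"
proof -
  interpret R: cring "polynomial_ring V :: (('v \<Rightarrow>\<^sub>0 nat) \<Rightarrow>\<^sub>0 'k::field) ring"
    by (rule cring_polynomial_ring)
  show "subring (carrier (polynomial_ring V :: (('v \<Rightarrow>\<^sub>0 nat) \<Rightarrow>\<^sub>0 'k::field) ring))"
  proof
    fix p assume "p \<in> carrier (polynomial_ring V :: (('v \<Rightarrow>\<^sub>0 nat) \<Rightarrow>\<^sub>0 'k::field) ring)"
    then show "- p \<in> carrier (polynomial_ring V)"
      by (simp add: polynomial_ring_def)
  qed (use R.zero_closed R.one_closed R.a_closed R.m_closed in auto)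
qed

lemma uminus_polynomial_ring:
  fixes p :: "('v \<Rightarrow>\<^sub>0 nat) \<Rightarrow>\<^sub>0 'k::field"
  assumes "p \<in> carrier (polynomial_ring V)"
  shows "\<ominus>\<^bsub>polynomial_ring V\<^esub> p = - p"
proof -
  interpret R: cring "polynomial_ring V :: (('v \<Rightarrow>\<^sub>0 nat) \<Rightarrow>\<^sub>0 'k::field) ring"
    by (rule cring_polynomial_ring)
  interpret S: subring "carrier (polynomial_ring V :: (('v \<Rightarrow>\<^sub>0 nat) \<Rightarrow>\<^sub>0 'k::field) ring)"
    by (rule subring_polynomial_ring)
  show ?thesis
    using assms by (intro R.minus_equality) (auto intro: S.uminus_closed)
qed

lemma ideal_of_iff_ideal:
  fixes I :: "(('v \<Rightarrow>\<^sub>0 nat) \<Rightarrow>\<^sub>0 'k::field) set"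
  shows "subring.ideal_of (carrier (polynomial_ring V)) I \<longleftrightarrow>
   ideal I (polynomial_ring V :: (('v \<Rightarrow>\<^sub>0 nat) \<Rightarrow>\<^sub>0 'k::field) ring)"
proof -
  interpret R: cring "polynomial_ring V :: (('v \<Rightarrow>\<^sub>0 nat) \<Rightarrow>\<^sub>0 'k::field) ring"
    by (rule cring_polynomial_ring)
  interpret S: subring "carrier (polynomial_ring V :: (('v \<Rightarrow>\<^sub>0 nat) \<Rightarrow>\<^sub>0 'k::field) ring)"
    by (rule subring_polynomial_ring)
  show ?thesis
  proof
    assume I: "S.ideal_of I"
    show "ideal I (polynomial_ring V)"
    proof (rule idealI[OF R.ring_axioms])
      show "subgroup I (add_monoid (polynomial_ring V :: (('v \<Rightarrow>\<^sub>0 nat) \<Rightarrow>\<^sub>0 'k::field) ring))"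
      proof (rule R.add.subgroupI)
        fix a assume a: "a \<in> I"
        then have "0 - a \<in> I"
          using S.ideal_of_diff[OF I S.ideal_ofD(2)[OF I]] by blast
        moreover have "\<ominus>\<^bsub>polynomial_ring V\<^esub> a = - a"
          by (rule uminus_polynomial_ring) (rule S.ideal_ofD(1)[OF I a])
        ultimately show "\<ominus>\<^bsub>polynomial_ring V\<^esub> a \<in> I"
          by simp
      qed (use S.ideal_ofD[OF I] in auto)
    qed (use S.ideal_ofD[OF I] in auto)
  next
    assume "ideal I (polynomial_ring V)"
    then interpret I: ideal I "polynomial_ring V :: (('v \<Rightarrow>\<^sub>0 nat) \<Rightarrow>\<^sub>0 'k::field) ring" .
    show "S.ideal_of I"
      unfolding S.ideal_of_def
      using I.Icarr I.zero_closed I.a_closed I.I_l_closed by auto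
  qed
qed

lemma submodule_smult_span:
  assumes "Module.module R M" "A \<subseteq> carrier R"
  shows "submodule (smult_span R M A) R M"
proof -
  interpret Module.module R M by fact
  let ?F = "{N. submodule N R M \<and> (\<forall>a\<in>A. \<forall>v\<in>carrier M. a \<odot>\<^bsub>M\<^esub> v \<in> N)}"
  have F: "carrier M \<in> ?F"
    using assms(2) carrier_is_submodule by auto
  show ?thesis
    unfolding smult_span_def
  proof (rule submoduleI)
    show "\<Inter> ?F \<subseteq> carrier M" using F by blast
    show "\<zero>\<^bsub>M\<^esub> \<in> \<Inter> ?F"
      using subgroup.one_closed[OF submodule.axioms(1)] by force
  qed (use submoduleE in auto)
qed

lemma smult_span_least:
  assumes "submodule N R M" "\<And>a v. a \<in> A \<Longrightarrow> v \<in> carrier M \<Longrightarrow> a \<odot>\<^bsub>M\<^esub> v \<in> N"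
  shows "smult_span R M A \<subseteq> N"
  using assms by (auto simp: smult_span_def)

lemma smult_span_mono: "A \<subseteq> B \<Longrightarrow> smult_span R M A \<subseteq> smult_span R M B"
  by (auto simp: smult_span_def)

lemma smult_in_smult_span: "a \<in> A \<Longrightarrow> v \<in> carrier M \<Longrightarrow> a \<odot>\<^bsub>M\<^esub> v \<in> smult_span R M A"
  by (auto simp: smult_span_def)

text \<open>
  The ideal of the polynomial ring that corresponds to the submodule spanned by \<open>A\<close> in the quotient by
  \<open>I\<close>. Regular sequences on the quotient module thereby become statements about a chain of ideals.
\<close>

definition preimage_span :: "'v set \<Rightarrow> (('v \<Rightarrow>\<^sub>0 nat) \<Rightarrow>\<^sub>0 'k::field) set \<Rightarrow>
    (('v \<Rightarrow>\<^sub>0 nat) \<Rightarrow>\<^sub>0 'k) set \<Rightarrow> (('v \<Rightarrow>\<^sub>0 nat) \<Rightarrow>\<^sub>0 'k) set" where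
  "preimage_span V I A = {p \<in> carrier (polynomial_ring V). I +>\<^bsub>polynomial_ring V\<^esub> p \<in>
     smult_span (polynomial_ring V) (quotient_module (polynomial_ring V) I) A}"

context
  fixes V :: "'v set" and I :: "(('v \<Rightarrow>\<^sub>0 nat) \<Rightarrow>\<^sub>0 'k::field) set"
    and R and M
  defines "R \<equiv> polynomial_ring V" and "M \<equiv> quotient_module R I"
  assumes I: "ideal I R"
begin

interpretation R: cring R
  unfolding R_def by (rule cring_polynomial_ring)

interpretation S: subring "carrier R"
  unfolding R_def by (rule subring_polynomial_ring)

interpretation I: ideal I R
  by (rule I)

interpretation M: Module.module R M
  unfolding M_def by (rule module_quotient_module[OF R.cring_axioms I])

lemma R_simps:
  "zero R = 0" "one R = 1" "p \<oplus>\<^bsub>R\<^esub> q = p + q" "p \<otimes>\<^bsub>R\<^esub> q = p * q"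
  by (simp_all add: R_def)

lemma carrier_quotient: "carrier M = (\<lambda>p. I +>\<^bsub>R\<^esub> p) ` carrier R"
  by (auto simp: M_def quotient_module_def FactRing_def A_RCOSETS_def')

lemma zero_quotient: "\<zero>\<^bsub>M\<^esub> = I"
  by (simp add: M_def quotient_module_def FactRing_def)

lemma add_quotient:
  "p \<in> carrier R \<Longrightarrow> q \<in> carrier R \<Longrightarrow> (I +>\<^bsub>R\<^esub> p) \<oplus>\<^bsub>M\<^esub> (I +>\<^bsub>R\<^esub> q) = I +>\<^bsub>R\<^esub> (p + q)"
  by (simp add: M_def quotient_module_def FactRing_def I.a_rcos_sum R_simps)

lemma smult_quotient:
  "p \<in> carrier R \<Longrightarrow> q \<in> carrier R \<Longrightarrow> p \<odot>\<^bsub>M\<^esub> (I +>\<^bsub>R\<^esub> q) = I +>\<^bsub>R\<^esub> (p * q)"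
  by (simp add: M_def quotient_module_def FactRing_def I.rcoset_mult_add R_simps)

lemma coset_eq_iff:
  assumes "p \<in> carrier R" "q \<in> carrier R"
  shows "I +>\<^bsub>R\<^esub> p = I +>\<^bsub>R\<^esub> q \<longleftrightarrow> p - q \<in> I"
  using R.quotient_eq_iff_same_a_r_cos[OF I assms] assms
  by (simp add: R_def a_minus_def uminus_polynomial_ring)

lemma coset_zero: "I +>\<^bsub>R\<^esub> 0 = I"
  using R.a_rcos_zero[OF I I.zero_closed] by (simp add: R_simps)

lemma preimage_span_alt: "preimage_span V I A = {p \<in> carrier R. I +>\<^bsub>R\<^esub> p \<in> smult_span R M A}"
  by (simp add: preimage_span_def R_def M_def)

lemma submodule_cosets:
  assumes N: "S.ideal_of N"
  shows "submodule ((\<lambda>p. I +>\<^bsub>R\<^esub> p) ` N) R M"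
proof (rule M.submoduleI)
  show "(\<lambda>p. I +>\<^bsub>R\<^esub> p) ` N \<subseteq> carrier M"
    using S.ideal_ofD(1)[OF N] by (auto simp: carrier_quotient)
  show "\<zero>\<^bsub>M\<^esub> \<in> (\<lambda>p. I +>\<^bsub>R\<^esub> p) ` N"
    using S.ideal_ofD(2)[OF N] coset_zero by (force simp: zero_quotient)
  fix X assume "X \<in> (\<lambda>p. I +>\<^bsub>R\<^esub> p) ` N"
  then obtain p where p: "p \<in> N" "X = I +>\<^bsub>R\<^esub> p" by auto
  then have pR: "p \<in> carrier R" and neg: "- p \<in> N"
    using S.ideal_ofD(1)[OF N] S.ideal_of_diff[OF N S.ideal_ofD(2)[OF N], of p] by auto
  then have "(I +>\<^bsub>R\<^esub> (- p)) \<oplus>\<^bsub>M\<^esub> X = \<zero>\<^bsub>M\<^esub>"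
    by (simp add: p add_quotient S.uminus_closed coset_zero zero_quotient)
  then have "\<ominus>\<^bsub>M\<^esub> X = I +>\<^bsub>R\<^esub> (- p)"
    using pR S.uminus_closed by (intro M.minus_equality) (auto simp: p carrier_quotient)
  then show "\<ominus>\<^bsub>M\<^esub> X \<in> (\<lambda>p. I +>\<^bsub>R\<^esub> p) ` N"
    using neg by simp
  show "r \<odot>\<^bsub>M\<^esub> X \<in> (\<lambda>p. I +>\<^bsub>R\<^esub> p) ` N" if "r \<in> carrier R" for r
    using that p pR S.ideal_ofD(4)[OF N] by (simp add: smult_quotient)
  fix Y assume "Y \<in> (\<lambda>p. I +>\<^bsub>R\<^esub> p) ` N"
  then obtain q where q: "q \<in> N" "Y = I +>\<^bsub>R\<^esub> q" by auto
  then show "X \<oplus>\<^bsub>M\<^esub> Y \<in> (\<lambda>p. I +>\<^bsub>R\<^esub> p) ` N"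
    using p pR S.ideal_ofD(1,3)[OF N] by (simp add: add_quotient)
qed

lemma ideal_of_preimage_span:
  assumes "A \<subseteq> carrier R"
  shows "S.ideal_of (preimage_span V I A)"
proof -
  have N: "submodule (smult_span R M A) R M"
    by (rule submodule_smult_span[OF M.module_axioms assms])
  have "I \<in> smult_span R M A"
    using subgroup.one_closed[OF submodule.axioms(1)[OF N]] by (simp add: zero_quotient)
  moreover have "I +>\<^bsub>R\<^esub> (p + q) \<in> smult_span R M A"
    if "p \<in> carrier R" "q \<in> carrier R" "I +>\<^bsub>R\<^esub> p \<in> smult_span R M A" "I +>\<^bsub>R\<^esub> q \<in> smult_span R M A"
    for p q
    using M.submoduleE(5)[OF N that(3,4)] that by (simp add: add_quotient)
  moreover have "I +>\<^bsub>R\<^esub> (p * q) \<in> smult_span R M A"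
    if "p \<in> carrier R" "q \<in> carrier R" "I +>\<^bsub>R\<^esub> q \<in> smult_span R M A" for p q
    using M.submoduleE(4)[OF N that(1,3)] that by (simp add: smult_quotient)
  ultimately show ?thesis
    unfolding S.ideal_of_def preimage_span_alt
    by (auto simp: coset_zero S.zero_closed S.add_closed S.mult_closed)
qed

lemma ideal_subset_preimage_span:
  assumes "A \<subseteq> carrier R"
  shows "I \<subseteq> preimage_span V I A"
proof
  fix p assume p: "p \<in> I"
  then have "I +>\<^bsub>R\<^esub> p = \<zero>\<^bsub>M\<^esub>"
    using R.a_rcos_zero[OF I] by (simp add: zero_quotient)
  then show "p \<in> preimage_span V I A"
    using submodule_smult_span[OF M.module_axioms assms] I.Icarr[OF p]
    by (metis (mono_tags) mem_Collect_eq monoid.simps(2) preimage_span_alt submodule.axioms(1)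
        subgroup.one_closed)
qed

lemma preimage_span_empty: "preimage_span V I {} = I"
proof
  have "S.ideal_of I"
    using I by (simp add: R_def ideal_of_iff_ideal)
  then have "smult_span R M {} \<subseteq> (\<lambda>p. I +>\<^bsub>R\<^esub> p) ` I"
    by (intro smult_span_least submodule_cosets) auto
  then have "smult_span R M {} \<subseteq> {I}"
    using R.a_rcos_zero[OF I] by auto
  then show "preimage_span V I {} \<subseteq> I"
    using coset_eq_iff[OF _ S.zero_closed] by (auto simp: preimage_span_alt coset_zero)
qed (simp add: ideal_subset_preimage_span)

lemma preimage_span_insert:
  assumes y: "y \<in> carrier R" and A: "A \<subseteq> carrier R"
  shows "preimage_span V I (insert y A) = {p + y * s | p s. p \<in> preimage_span V I A \<and> s \<in> carrier R}"
    (is "?L = ?N")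
proof
  have idA: "S.ideal_of (preimage_span V I A)" and idL: "S.ideal_of ?L"
    using assms by (simp_all add: ideal_of_preimage_span)
  have "preimage_span V I A \<subseteq> ?L"
    using subsetD[OF smult_span_mono[of A "insert y A" R M]] by (auto simp: preimage_span_alt)
  moreover have "y * s \<in> ?L" if "s \<in> carrier R" for s
  proof -
    have "y \<odot>\<^bsub>M\<^esub> (I +>\<^bsub>R\<^esub> s) \<in> smult_span R M (insert y A)"
      using that by (intro smult_in_smult_span) (auto simp: carrier_quotient)
    with that y show ?thesis
      by (simp add: preimage_span_alt smult_quotient S.mult_closed)
  qed
  ultimately show "?N \<subseteq> ?L"
    using S.ideal_ofD(3)[OF idL] by auto
  have idN: "S.ideal_of ?N"
    unfolding S.ideal_of_def
  proof (intro conjI ballI subsetI)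
    fix p assume "p \<in> ?N"
    then show "p \<in> carrier R"
      using S.ideal_ofD(1)[OF idA] y by (auto intro: S.add_closed S.mult_closed)
  next
    show "0 \<in> ?N"
      using S.ideal_ofD(2)[OF idA] S.zero_closed by force
  next
    fix p q assume "p \<in> ?N" "q \<in> ?N"
    then obtain p' s q' t where *: "p' \<in> preimage_span V I A" "q' \<in> preimage_span V I A"
      "s \<in> carrier R" "t \<in> carrier R" "p = p' + y * s" "q = q' + y * t"
      by auto
    then have "p + q = (p' + q') + y * (s + t)"
      by (simp add: algebra_simps)
    with * show "p + q \<in> ?N"
      using S.ideal_ofD(3)[OF idA] S.add_closed by blast
  next
    fix r p assume "r \<in> carrier R" "p \<in> ?N"
    then obtain p' s where *: "r \<in> carrier R" "p' \<in> preimage_span V I A"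
      "s \<in> carrier R" "p = p' + y * s"
      by auto
    then have "r * p = r * p' + y * (r * s)"
      by (simp add: algebra_simps)
    with * show "r * p \<in> ?N"
      using S.ideal_ofD(4)[OF idA] S.mult_closed by blast
  qed
  have "smult_span R M (insert y A) \<subseteq> (\<lambda>p. I +>\<^bsub>R\<^esub> p) ` ?N"
  proof (rule smult_span_least[OF submodule_cosets[OF idN]])
    fix a X assume a: "a \<in> insert y A" and "X \<in> carrier M"
    then obtain q where q: "q \<in> carrier R" "X = I +>\<^bsub>R\<^esub> q"
      by (auto simp: carrier_quotient)
    have aR: "a \<in> carrier R" using a assms by auto
    have "a * q \<in> ?N"
    proof (cases "a = y")
      case True
      have "a * q = 0 + y * q" by (simp add: True)
      then show ?thesis using S.ideal_ofD(2)[OF idA] q by blast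
    next
      case False
      with a have "a \<odot>\<^bsub>M\<^esub> X \<in> smult_span R M A"
        using q by (intro smult_in_smult_span) (auto simp: carrier_quotient)
      then have "a * q \<in> preimage_span V I A"
        using q aR by (simp add: preimage_span_alt smult_quotient S.mult_closed)
      moreover have "a * q = a * q + y * 0" by simp
      ultimately show ?thesis using S.zero_closed by blast
    qed
    then show "a \<odot>\<^bsub>M\<^esub> X \<in> (\<lambda>p. I +>\<^bsub>R\<^esub> p) ` ?N"
      using q aR by (simp add: smult_quotient)
  qed
  moreover have "I \<subseteq> ?N"
  proof
    fix p assume "p \<in> I"
    then have "p \<in> preimage_span V I A"
      using ideal_subset_preimage_span[OF A] by blast
    moreover have "p = p + y * 0" by simp
    ultimately show "p \<in> ?N" using S.zero_closed by blast
  qed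
  ultimately show "?L \<subseteq> ?N"
  proof (intro subsetI)
    fix p assume sub: "smult_span R M (insert y A) \<subseteq> (\<lambda>p. I +>\<^bsub>R\<^esub> p) ` ?N"
      and IN: "I \<subseteq> ?N" and "p \<in> ?L"
    then have p: "p \<in> carrier R" and pI: "I +>\<^bsub>R\<^esub> p \<in> smult_span R M (insert y A)"
      by (simp_all add: preimage_span_alt)
    have "I +>\<^bsub>R\<^esub> p \<in> (\<lambda>p. I +>\<^bsub>R\<^esub> p) ` ?N"
      by (rule subsetD[OF sub pI])
    then obtain q where q: "I +>\<^bsub>R\<^esub> p = I +>\<^bsub>R\<^esub> q" "q \<in> ?N"
      by (rule imageE)
    then have "p - q \<in> I"
      using coset_eq_iff[of p q] p S.ideal_ofD(1)[OF idN q(2)] by simp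
    then have "(p - q) + q \<in> ?N"
      using IN q by (intro S.ideal_ofD(3)[OF idN]) auto
    then show "p \<in> ?N" by simp
  qed
qed

text \<open>
  For a regular sequence \<open>ys\<close>, the preimages of the submodules spanned by its initial segments form
  the chain of ideals to which \<open>regular_length_le\<close> applies.
\<close>

theorem depth_quotient_le:
  assumes V: "finite V" and z: "\<And>v. v \<in> V \<Longrightarrow> z v \<in> carrier R"
    and xz: "\<And>v. v \<in> V \<Longrightarrow> \<exists>r\<in>carrier R. var v * var v = r * z v"
    and H: "S.nonzero_cohomology V z I d"
  shows "depth R (graded_maximal_ideal V) M \<le> enat d"
  unfolding depth_def
proof (rule Sup_least, clarify)
  fix ys assume ys: "set ys \<subseteq> graded_maximal_ideal V" and reg: "regular_sequence R M ys"
  have var: "var v \<in> carrier R" if "v \<in> V" for v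
    using that by (auto simp: R_def polynomial_ring_def var_def)
  have ysR: "set ys \<subseteq> carrier R"
    using reg by (simp add: regular_sequence_def)
  then have tk: "set (take t ys) \<subseteq> carrier R" for t
    using set_take_subset by fastforce
  have "length ys \<le> d"
  proof (rule S.regular_length_le[where x = var and z = z and V = V and j = d
        and y = "\<lambda>t. ys ! t" and Is = "\<lambda>t. preimage_span V I (set (take t ys))"])
    show "S.ideal_of (preimage_span V I (set (take t ys)))" for t
      by (rule ideal_of_preimage_span[OF tk])
    show yR: "ys ! t \<in> carrier R" if "t < length ys" for t
      using ysR that by (meson nth_mem subsetD)
    show "ys ! t \<in> T" if "t < length ys" "S.ideal_of T" "var ` V \<subseteq> T" for t T
    proof -
      have "ideal T R"
        using that(2) by (simp add: R_def ideal_of_iff_ideal)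
      then have "graded_maximal_ideal V \<subseteq> T"
        unfolding graded_maximal_ideal_def R_def[symmetric]
        using that(3) by (rule R.genideal_minimal)
      with ys that(1) show ?thesis by (meson nth_mem subsetD)
    qed
    show "p \<in> preimage_span V I (set (take t ys))"
      if "t < length ys" "p \<in> carrier R" "ys ! t * p \<in> preimage_span V I (set (take t ys))" for t p
    proof -
      have "(ys ! t) \<odot>\<^bsub>M\<^esub> (I +>\<^bsub>R\<^esub> p) \<in> smult_span R M (set (take t ys))"
        using that yR[OF that(1)] by (simp add: preimage_span_alt smult_quotient)
      then have "I +>\<^bsub>R\<^esub> p \<in> smult_span R M (set (take t ys))"
        using reg that(1,2) by (auto simp: regular_sequence_def carrier_quotient)
      with that(2) show ?thesis by (simp add: preimage_span_alt)
    qed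
    show "preimage_span V I (set (take (Suc t) ys)) =
        {a + ys ! t * s |a s. a \<in> preimage_span V I (set (take t ys)) \<and> s \<in> carrier R}"
      if "t < length ys" for t
      using preimage_span_insert[OF yR[OF that] tk] that by (simp add: take_Suc_conv_app_nth)
    show "S.nonzero_cohomology V z (preimage_span V I (set (take 0 ys))) d"
      using H by (simp add: preimage_span_empty)
  qed (use V z xz var in auto)
  then show "enat (length ys) \<le> enat d" by simp
qed

end

section \<open>A combinatorial bound for the depth of an edge ideal\<close>

text \<open>
  Linear functionals that add up coefficients over a set of monomials detect that a polynomial lies
  outside an ideal. They interact with multiplication by a monomial through a shift of the set.
\<close>

definition coeff_sum :: "'m set \<Rightarrow> ('m \<Rightarrow>\<^sub>0 'k::comm_monoid_add) \<Rightarrow> 'k" where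
  "coeff_sum M p = (\<Sum>t\<in>Poly_Mapping.keys p. if t \<in> M then Poly_Mapping.lookup p t else 0)"

lemma coeff_sum_superset:
  assumes "finite B" "Poly_Mapping.keys p \<subseteq> B"
  shows "coeff_sum M p = (\<Sum>t\<in>B. if t \<in> M then Poly_Mapping.lookup p t else 0)"
  unfolding coeff_sum_def
  by (rule sum.mono_neutral_left) (use assms in \<open>auto simp: in_keys_iff\<close>)

lemma coeff_sum_zero: "coeff_sum M 0 = 0"
  by (simp add: coeff_sum_def)

lemma coeff_sum_add: "coeff_sum M (p + q) = coeff_sum M p + coeff_sum M q"
proof -
  let ?B = "Poly_Mapping.keys p \<union> Poly_Mapping.keys q"
  have "coeff_sum M (p + q) = (\<Sum>t\<in>?B. if t \<in> M then Poly_Mapping.lookup (p + q) t else 0)"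
    by (rule coeff_sum_superset) (auto dest: subsetD[OF Poly_Mapping.keys_add])
  also have "\<dots> = (\<Sum>t\<in>?B. if t \<in> M then Poly_Mapping.lookup p t else 0) +
      (\<Sum>t\<in>?B. if t \<in> M then Poly_Mapping.lookup q t else 0)"
    unfolding sum.distrib[symmetric] by (rule sum.cong) (auto simp: lookup_add)
  also have "\<dots> = coeff_sum M p + coeff_sum M q"
    by (simp add: coeff_sum_superset[where B = ?B])
  finally show ?thesis .
qed

lemma coeff_sum_sum: "coeff_sum M (\<Sum>i\<in>A. p i) = (\<Sum>i\<in>A. coeff_sum M (p i))"
  by (induction A rule: infinite_finite_induct) (simp_all add: coeff_sum_zero coeff_sum_add)

lemma coeff_sum_diff:
  fixes p q :: "'m \<Rightarrow>\<^sub>0 'k::ab_group_add"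
  shows "coeff_sum M (p - q) = coeff_sum M p - coeff_sum M q"
  using coeff_sum_add[of M "p - q" q] by simp

lemma coeff_sum_single: "coeff_sum M (Poly_Mapping.single t c) = (if t \<in> M then c else 0)"
  by (simp add: coeff_sum_def)

lemma sum_single_lookup: "p = (\<Sum>t\<in>Poly_Mapping.keys p. Poly_Mapping.single t (Poly_Mapping.lookup p t))"
proof (rule poly_mapping_eqI)
  fix k
  have "Poly_Mapping.lookup (\<Sum>t\<in>Poly_Mapping.keys p. Poly_Mapping.single t (Poly_Mapping.lookup p t)) k =
      (\<Sum>t\<in>Poly_Mapping.keys p. if t = k then Poly_Mapping.lookup p t else 0)"
    unfolding lookup_sum by (rule sum.cong) (auto simp: lookup_single when_def)
  then show "Poly_Mapping.lookup p k =
      Poly_Mapping.lookup (\<Sum>t\<in>Poly_Mapping.keys p. Poly_Mapping.single t (Poly_Mapping.lookup p t)) k"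
    by (simp add: in_keys_iff)
qed

lemma coeff_sum_times_monomial:
  fixes p :: "'m::comm_monoid_add \<Rightarrow>\<^sub>0 'k::comm_ring_1"
  shows "coeff_sum M (p * Poly_Mapping.single s 1) = coeff_sum {t. s + t \<in> M} p"
proof -
  have "p * Poly_Mapping.single s 1 =
      (\<Sum>t\<in>Poly_Mapping.keys p. Poly_Mapping.single (s + t) (Poly_Mapping.lookup p t))"
    by (subst sum_single_lookup[of p]) (simp add: sum_distrib_right mult_single add.commute)
  then show ?thesis
    by (simp add: coeff_sum_sum coeff_sum_single) (simp add: coeff_sum_def)
qed

lemma prod_var:
  assumes "finite A"
  shows "(\<Prod>a\<in>A. var a) = (Poly_Mapping.single (\<Sum>a\<in>A. Poly_Mapping.single a 1) 1 ::
    ('v \<Rightarrow>\<^sub>0 nat) \<Rightarrow>\<^sub>0 'k::field)"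
  using assms by (induction A) (simp_all add: var_def mult_single)

lemma lookup_sum_single:
  assumes "finite A"
  shows "Poly_Mapping.lookup (\<Sum>a\<in>A. Poly_Mapping.single a (1::nat)) v = (if v \<in> A then 1 else 0)"
proof -
  have "Poly_Mapping.lookup (\<Sum>a\<in>A. Poly_Mapping.single a (1::nat)) v = (\<Sum>a\<in>A. if a = v then 1 else 0)"
    unfolding lookup_sum by (rule sum.cong) (auto simp: lookup_single when_def)
  with assms show ?thesis by simp
qed

lemma sum_lookup_single_add:
  assumes "finite Q"
  shows "(\<Sum>v\<in>Q. Poly_Mapping.lookup (Poly_Mapping.single a (1::nat) + t) v) =
    (if a \<in> Q then 1 else 0) + (\<Sum>v\<in>Q. Poly_Mapping.lookup t v)"
proof -
  have "(\<Sum>v\<in>Q. Poly_Mapping.lookup (Poly_Mapping.single a (1::nat)) v) = (\<Sum>v\<in>Q. if v = a then 1 else 0)"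
    by (rule sum.cong) (auto simp: lookup_single when_def)
  with assms show ?thesis
    by (simp add: lookup_add sum.distrib)
qed

lemma keys_single_add:
  "Poly_Mapping.keys (Poly_Mapping.single a (1::nat) + t) = insert a (Poly_Mapping.keys t)"
  by (auto simp: in_keys_iff lookup_add lookup_single when_def split: if_splits)

text \<open>
  The parts \<open>U a\<close> are indexed by a representative \<open>a\<close>, and \<open>b a\<close> is the vertex opposite to \<open>a\<close> in the
  cross-polytope; the vertices in \<open>F\<close> form parts of their own and have no opposite vertex. With
  \<open>z v = x v\<close> outside \<open>F\<close> and \<open>z v = x v * x v\<close> on \<open>F\<close>, the cocycle is the product of the forms
  \<open>\<phi> a\<close>, where \<open>\<phi> a v\<close> is \<open>x v\<close> on \<open>U a\<close> and 0 elsewhere.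

  It is a cocycle: the part of \<open>z\<close> supported on \<open>U a\<close> is a multiple of \<open>\<phi> a\<close> and contributes 0, and
  the remaining part multiplies the product into \<open>I\<close>, because a vertex outside the parts together
  with a choice of one vertex in each part always contains an edge. It is not a coboundary: contraction with all \<open>a\<close> in \<open>F\<close> and all
  differences of \<open>a\<close> and \<open>b a\<close> yields the product of the variables in \<open>A\<close>, while
  coboundaries yield elements of the ideal generated by \<open>I\<close>, the squares of the variables in \<open>F\<close> and
  the differences of opposite variables. Identifying opposite variables maps this ideal into
  the one generated by the squares of variables and by the variables outside \<open>F\<close> and the
  cross-polytope, and the product of the variables in \<open>A\<close> to a monomial that is not in it.

  The square on \<open>F\<close> is essential: with \<open>z v = x v\<close> there, the product would lie in that ideal.
\<close>

theorem depth_edge_ideal_le: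
  fixes G :: "'v pair_pre_digraph"
  assumes G: "pair_graph G" and A: "A \<subseteq> pverts G" and F: "F \<subseteq> A"
    and part: "\<And>a. a \<in> A \<Longrightarrow> a \<in> U a" "\<And>a. a \<in> A \<Longrightarrow> U a \<subseteq> pverts G"
    and disj: "\<And>a a'. a \<in> A \<Longrightarrow> a' \<in> A \<Longrightarrow> a \<noteq> a' \<Longrightarrow> U a \<inter> U a' = {}"
    and single: "\<And>a. a \<in> F \<Longrightarrow> U a = {a}"
    and b: "\<And>a. a \<in> A - F \<Longrightarrow> b a \<in> pverts G - \<Union> (U ` A)" and inj: "inj_on b (A - F)"
    and no_transversal: "\<And>u v. v \<in> pverts G - \<Union> (U ` A) \<Longrightarrow> (\<And>a. a \<in> A \<Longrightarrow> u a \<in> U a) \<Longrightarrow>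
      \<exists>p\<in>insert v (u ` A). \<exists>q\<in>insert v (u ` A). (p, q) \<in> parcs G"
    and separated: "\<And>a a' p q. a \<in> A \<Longrightarrow> a' \<in> A \<Longrightarrow> a \<noteq> a' \<Longrightarrow>
      p \<in> (if a \<in> F then {a} else {a, b a}) \<Longrightarrow> q \<in> (if a' \<in> F then {a'} else {a', b a'}) \<Longrightarrow>
      (p, q) \<notin> parcs G"
  shows "depth (polynomial_ring (pverts G) :: (('v \<Rightarrow>\<^sub>0 nat) \<Rightarrow>\<^sub>0 'k::field) ring)
      (graded_maximal_ideal (pverts G))
      (quotient_module (polynomial_ring (pverts G)) (edge_ideal G)) \<le> enat (card A)"
proof -
  define V where "V = pverts G"
  define S where "S = carrier (polynomial_ring V :: (('v \<Rightarrow>\<^sub>0 nat) \<Rightarrow>\<^sub>0 'k) ring)"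
  define I :: "(('v \<Rightarrow>\<^sub>0 nat) \<Rightarrow>\<^sub>0 'k) set" where "I = edge_ideal G"
  define W where "W = \<Union> (U ` A)"
  define Q where "Q a = (if a \<in> F then {a} else {a, b a})" for a
  define x :: "'v \<Rightarrow> ('v \<Rightarrow>\<^sub>0 nat) \<Rightarrow>\<^sub>0 'k" where "x = var"
  define z where "z v = x v * (if v \<in> F then x v else 1)" for v
  define \<phi> where "\<phi> a v = (if v \<in> U a then x v else 0)" for a v
  define \<xi> :: "'v \<Rightarrow> 'v \<Rightarrow> ('v \<Rightarrow>\<^sub>0 nat) \<Rightarrow>\<^sub>0 'k" where
    "\<xi> a v = (if v = a then 1 else 0) - (if a \<notin> F \<and> v = b a then 1 else 0)" for a v
  interpret G: pair_graph G by fact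
  interpret R: cring "polynomial_ring V :: (('v \<Rightarrow>\<^sub>0 nat) \<Rightarrow>\<^sub>0 'k) ring"
    by (rule cring_polynomial_ring)
  interpret S: subring S
    unfolding S_def by (rule subring_polynomial_ring)
  have V: "finite V"
    unfolding V_def by (rule G.pair_finite_verts)
  have finA: "finite A"
    using A V by (auto simp: V_def intro: finite_subset)
  have AW: "A \<subseteq> W" and WV: "W \<subseteq> V"
    using part by (auto simp: W_def V_def)
  have xS: "x v \<in> S" if "v \<in> V" for v
    using that by (auto simp: x_def S_def polynomial_ring_def var_def)
  have zS: "z v \<in> S" if "v \<in> V" for v
    using xS[OF that] by (auto simp: z_def intro: S.mult_closed S.one_closed)
  have \<phi>S: "\<phi> a v \<in> S" if "v \<in> V" for a v
    using xS[OF that] by (simp add: \<phi>_def S.zero_closed)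
  have \<xi>S: "\<xi> a v \<in> S" for a v
    unfolding \<xi>_def by (intro S.diff_closed) (auto simp: S.zero_closed S.one_closed)
  have bA: "b a \<in> V" "b a \<notin> W" if "a \<in> A" "a \<notin> F" for a
    using b[of a] that by (auto simp: W_def V_def)
  have gens: "{x u * x v | u v. (u, v) \<in> parcs G} \<subseteq> S"
    using G.arc_fst_in_verts G.arc_snd_in_verts by (fastforce simp: V_def[symmetric] intro: S.mult_closed xS)
  have I_eq: "I = genideal (polynomial_ring V) {x u * x v | u v. (u, v) \<in> parcs G}"
    by (simp add: I_def edge_ideal_def V_def x_def)
  have idealI: "ideal I (polynomial_ring V)"
    unfolding I_eq using gens by (intro R.genideal_ideal) (simp add: S_def)
  then have I: "S.ideal_of I"
    by (simp add: S_def ideal_of_iff_ideal)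
  have edge: "x u * x v \<in> I" if "(u, v) \<in> parcs G" for u v
    using that R.genideal_self[OF gens[unfolded S_def]] by (auto simp: I_eq)
  obtain as where as: "set as = A" "distinct as"
    using finite_distinct_list[OF finA] by blast
  have len: "length as = card A"
    using as distinct_card by force
  define c where "c = wedge_prod (map \<phi> as)"
  have "S.cocycle V z I (card A) c"
    unfolding S.cocycle_def
  proof (intro conjI allI impI)
    fix l assume l: "set l \<subseteq> V"
    show "c l \<in> S"
      unfolding c_def by (rule S.wedge_prod_closed[OF l]) (use \<phi>S in auto)
    (* z' is the part of z off the sets U a; on U a the form z is w a times \<phi> a. *)
    define z' where "z' v = (if v \<in> W then 0 else z v)" for v
    define w where "w a = (if a \<in> F then x a else 1)" for a
    have "z v = z' v + (\<Sum>a\<in>A. w a * \<phi> a v)" for v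
    proof (cases "v \<in> W")
      case False
      then have "\<And>a. a \<in> A \<Longrightarrow> \<phi> a v = 0" by (auto simp: \<phi>_def W_def)
      with False show ?thesis by (simp add: z'_def)
    next
      case True
      then obtain a where a: "a \<in> A" "v \<in> U a" by (auto simp: W_def)
      have "(\<Sum>a'\<in>A. w a' * \<phi> a' v) = (\<Sum>a'\<in>A. if a' = a then w a * x v else 0)"
        using a disj by (intro sum.cong) (auto simp: \<phi>_def)
      also have "\<dots> = w a * x v"
        using finA a(1) by simp
      also have "w a * x v = z v"
      proof (cases "a \<in> F")
        case True
        then have "v = a" using a single by auto
        with True show ?thesis by (simp add: z_def w_def)
      next
        case False
        then have "v \<notin> F" using a disj[of a v] part(1)[of v] F by auto
        with False show ?thesis by (simp add: z_def w_def)
      qed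
      finally show ?thesis
        using True by (simp add: z'_def)
    qed
    then have "wedge z c l = wedge (\<lambda>v. z' v + (\<Sum>a\<in>A. w a * \<phi> a v)) c l"
      by (intro wedge_cong) auto
    also have "\<dots> = wedge z' c l + (\<Sum>a\<in>A. w a * wedge (\<phi> a) c l)"
      by (simp add: wedge_form_add wedge_form_sum wedge_form_scale)
    also have "\<dots> = wedge z' c l"
      by (simp add: c_def wedge_wedge_prod_eq_0 as)
    also have "\<dots> \<in> I"
    proof (rule S.wedge_in_ideal[OF I l])
      fix v l' assume v: "v \<in> V" and l': "set l' \<subseteq> V"
      show "z' v * c l' \<in> I"
        unfolding c_def
      proof (rule S.wedge_prod_in_ideal[OF I as(2) l'], unfold as(1))
        fix u assume u: "\<And>a. a \<in> A \<Longrightarrow> u a \<in> V"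
        show "z' v * (\<Prod>a\<in>A. \<phi> a (u a)) \<in> I"
        proof (cases "v \<notin> W \<and> (\<forall>a\<in>A. u a \<in> U a)")
          case False
          moreover have "(\<Prod>a\<in>A. \<phi> a (u a)) = 0" if "a \<in> A" "u a \<notin> U a" for a
            by (rule prod_zero[OF finA]) (use that in \<open>auto simp: \<phi>_def\<close>)
          ultimately have "z' v = 0 \<or> (\<Prod>a\<in>A. \<phi> a (u a)) = 0"
            by (auto simp: z'_def)
          then show ?thesis using S.ideal_ofD(2)[OF I] by auto
        next
          case True
          then obtain p q where pq: "p \<in> insert v (u ` A)" "q \<in> insert v (u ` A)" "(p, q) \<in> parcs G"
            using no_transversal[of v u] v by (auto simp: V_def W_def)
          then have "p \<noteq> q" using G.pair_no_loops by force
          have "inj_on u A"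
            using True disj by (fastforce simp: inj_on_def)
          have "v \<notin> u ` A" using True by (auto simp: W_def)
          have "x v * (\<Prod>a\<in>A. \<phi> a (u a)) = x v * (\<Prod>a\<in>A. x (u a))"
            using True by (simp add: \<phi>_def)
          also have "\<dots> = x v * (\<Prod>y\<in>u ` A. x y)"
            using \<open>inj_on u A\<close> by (simp add: prod.reindex)
          also have "\<dots> = (\<Prod>y\<in>insert v (u ` A). x y)"
            using \<open>v \<notin> u ` A\<close> finA by simp
          also have "\<dots> = x p * (x q * (\<Prod>y\<in>insert v (u ` A) - {p} - {q}. x y))"
            using pq \<open>p \<noteq> q\<close> finA by (simp add: prod.remove[of _ p] prod.remove[of _ q])
          finally have "x v * (\<Prod>a\<in>A. \<phi> a (u a)) =
            x p * x q * (\<Prod>y\<in>insert v (u ` A) - {p} - {q}. x y)" by (simp add: mult.assoc)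
          moreover have prod_closed: "(\<Prod>y\<in>B. x y) \<in> S" if "B \<subseteq> V" for B
            using that by (induction B rule: infinite_finite_induct)
              (auto intro: S.one_closed S.mult_closed xS)
          have "insert v (u ` A) - {p} - {q} \<subseteq> V"
            using u v by auto
          then have "x p * x q * (\<Prod>y\<in>insert v (u ` A) - {p} - {q}. x y) \<in> I"
            by (intro S.ideal_ofD(5)[OF I edge[OF pq(3)]] prod_closed)
          ultimately have "x v * (\<Prod>a\<in>A. \<phi> a (u a)) \<in> I"
            by simp
          moreover have "(if v \<in> F then x v else 1) \<in> S"
            using xS[OF v] S.one_closed by simp
          ultimately have "(if v \<in> F then x v else 1) * (x v * (\<Prod>a\<in>A. \<phi> a (u a))) \<in> I"
            using S.ideal_ofD(4)[OF I] by blast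
          with True show ?thesis
            by (simp add: z'_def z_def ac_simps)
        qed
      qed
    qed
    finally show "wedge z c l \<in> I" .
  qed
  moreover have "\<not> S.coboundary V z I (card A) c"
  proof
    assume "S.coboundary V z I (card A) c"
    then obtain e where e: "\<And>l. set l \<subseteq> V \<Longrightarrow> e l \<in> S"
      "\<And>l. set l \<subseteq> V \<Longrightarrow> length l = card A \<Longrightarrow> c l - wedge z e l \<in> I"
      unfolding S.coboundary_def by auto
    (* M consists of the exponents that the identification of opposite variables sends to the
       product of the variables in A, so coeff_sum M reads off the coefficient of that product
       after the identification, and L is the largest ideal on which it vanishes. *)
    define M where "M = {t :: 'v \<Rightarrow>\<^sub>0 nat. Poly_Mapping.keys t \<subseteq> \<Union> (Q ` A) \<and>
      (\<forall>a\<in>A. (\<Sum>v\<in>Q a. Poly_Mapping.lookup t v) = 1)}"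
    define L where "L = {p \<in> S. \<forall>q\<in>S. coeff_sum M (q * p) = 0}"
    have finQ: "finite (Q a)" for a by (simp add: Q_def)
    have L: "S.ideal_of L"
      unfolding S.ideal_of_def L_def
      by (auto simp: S.zero_closed S.add_closed S.mult_closed coeff_sum_zero coeff_sum_add
          distrib_left simp flip: mult.assoc)
    have LI: "x u * x v \<in> L" if uv: "u \<in> V" "v \<in> V"
      and not: "\<And>t. Poly_Mapping.single u 1 + (Poly_Mapping.single v 1 + t) \<notin> M" for u v
    proof -
      have "coeff_sum M (q * (x u * x v)) = 0" for q
      proof -
        have "q * (x u * x v) =
            q * Poly_Mapping.single (Poly_Mapping.single u 1 + Poly_Mapping.single v 1) 1"
          by (simp add: x_def var_def mult_single)
        then show ?thesis
          using not by (simp add: coeff_sum_times_monomial add.assoc) (simp add: coeff_sum_def)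
      qed
      with uv show ?thesis by (simp add: L_def S.mult_closed xS)
    qed
    have twice: "Poly_Mapping.single u 1 + (Poly_Mapping.single v 1 + t) \<notin> M"
      if "a \<in> A" "u \<in> Q a" "v \<in> Q a" for a u v t
    proof
      assume "Poly_Mapping.single u 1 + (Poly_Mapping.single v 1 + t) \<in> M"
      then have "(\<Sum>w\<in>Q a. Poly_Mapping.lookup
          (Poly_Mapping.single u 1 + (Poly_Mapping.single v 1 + t)) w) = 1"
        using that(1) by (simp add: M_def)
      with that(2,3) show False
        unfolding sum_lookup_single_add[OF finQ] by simp
    qed
    have edge_not: "Poly_Mapping.single u 1 + (Poly_Mapping.single v 1 + t) \<notin> M"
      if uv: "(u, v) \<in> parcs G" for u v t
    proof
      assume M: "Poly_Mapping.single u 1 + (Poly_Mapping.single v 1 + t) \<in> M"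
      then obtain a a' where a: "a \<in> A" "u \<in> Q a" "a' \<in> A" "v \<in> Q a'"
        unfolding M_def by (auto simp: keys_single_add simp del: One_nat_def)
      then show False
        using separated[OF a(1,3), of u v] uv M twice[of a u v t] by (auto simp: Q_def)
    qed
    have "I \<subseteq> L"
      unfolding I_eq
    proof (rule R.genideal_minimal)
      show "ideal L (polynomial_ring V)"
        using L by (simp add: S_def ideal_of_iff_ideal)
      show "{x u * x v | u v. (u, v) \<in> parcs G} \<subseteq> L"
        using LI edge_not G.arc_fst_in_verts G.arc_snd_in_verts by (fastforce simp: V_def)
    qed
    have pairing: "(\<Sum>v\<in>V. \<xi> a v * f v) = f a - (if a \<in> F then 0 else f (b a))" if "a \<in> A" for a f
    proof -
      have "(\<Sum>v\<in>V. \<xi> a v * f v) = (\<Sum>v\<in>V. if v = a then f v else 0) -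
          (\<Sum>v\<in>V. if a \<notin> F \<and> v = b a then f v else 0)"
        unfolding sum_subtractf[symmetric] by (rule sum.cong) (auto simp: \<xi>_def left_diff_distrib)
      moreover have "(\<Sum>v\<in>V. if a \<notin> F \<and> v = b a then f v else 0) = (if a \<in> F then 0 else f (b a))"
        using V bA[OF that] by (cases "a \<in> F") auto
      ultimately show ?thesis
        using V that A by (auto simp: V_def)
    qed
    have \<xi>z: "(\<Sum>v\<in>V. \<xi> a v * z v) \<in> L" if a: "a \<in> A" for a
    proof (cases "a \<in> F")
      case True
      then have "x a * x a \<in> L"
        using a A by (intro LI twice[of a]) (auto simp: Q_def V_def)
      then show ?thesis
        using True a by (simp add: pairing z_def)
    next
      case False
      have bF: "b a \<notin> F" using bA[OF a False] AW F by auto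
      have in_Q: "a \<in> Q a' \<longleftrightarrow> a' = a" "b a \<in> Q a' \<longleftrightarrow> a' = a" if a': "a' \<in> A" for a'
      proof -
        show "a \<in> Q a' \<longleftrightarrow> a' = a"
          using a' a False bA[of a'] AW by (auto simp: Q_def)
        show "b a \<in> Q a' \<longleftrightarrow> a' = a"
          using a' a False bA[of a] AW inj by (auto simp: Q_def inj_on_def)
      qed
      have "(Poly_Mapping.single a 1 + t \<in> M) = (Poly_Mapping.single (b a) 1 + t \<in> M)" for t
      proof -
        have "a \<in> \<Union> (Q ` A)" "b a \<in> \<Union> (Q ` A)" using in_Q a by blast+
        then show ?thesis
          by (auto simp: M_def keys_single_add sum_lookup_single_add finQ in_Q simp del: One_nat_def)
      qed
      then have "coeff_sum M (q * x a) = coeff_sum M (q * x (b a))" for q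
        by (simp add: x_def var_def coeff_sum_times_monomial)
      then have "x a - x (b a) \<in> L"
        using a A bA[OF a False] by (auto simp: L_def V_def right_diff_distrib coeff_sum_diff
          intro!: S.diff_closed xS)
      then show ?thesis
        using False bF a by (simp add: pairing z_def)
    qed
    let ?\<xi>s = "map \<xi> as"
    have "contract_list V ?\<xi>s (\<lambda>l. c l - wedge z e l) [] \<in> L"
    proof (rule S.contract_list_in_ideal[OF L])
      show "c l - wedge z e l \<in> L" if "set l \<subseteq> V" "length l = length ?\<xi>s + 0" for l
        using e(2)[OF that(1)] that(2) len \<open>I \<subseteq> L\<close> by auto
    qed (use \<xi>S in auto)
    moreover have "contract_list V ?\<xi>s (wedge z e) [] \<in> L"
      by (rule S.contract_list_wedge_in_ideal[OF L]) (use \<xi>S \<xi>z e as in auto)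
    ultimately have "contract_list V ?\<xi>s c [] \<in> L"
      using S.ideal_ofD(3)[OF L] by (force simp: contract_list_diff)
    moreover have "contract_list V ?\<xi>s c [] = prod_list (map x as)"
      unfolding c_def
    proof (rule contract_list_wedge_prod[OF as(2)])
      fix a a' assume "a \<in> set as" "a' \<in> set as"
      then have a: "a \<in> A" "a' \<in> A" using as by auto
      have "a \<in> U a' \<longleftrightarrow> a = a'"
        using part(1)[of a] part(1)[of a'] disj[of a a'] a by auto
      moreover have "b a \<notin> U a'" if "a \<notin> F"
        using bA[OF a(1) that] a(2) by (auto simp: W_def)
      ultimately show "(\<Sum>v\<in>V. \<xi> a v * \<phi> a' v) = (if a = a' then x a else 0)"
        by (simp add: pairing[OF a(1)] \<phi>_def)
    qed
    moreover have "prod_list (map x as) = (\<Prod>a\<in>A. x a)"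
      using as prod.distinct_set_conv_list by metis
    ultimately have "coeff_sum M (1 * (\<Prod>a\<in>A. x a)) = 0"
      using S.one_closed unfolding L_def by auto
    then have "(\<Sum>a\<in>A. Poly_Mapping.single a 1) \<notin> M"
      by (simp add: x_def prod_var[OF finA] coeff_sum_single split: if_splits)
    moreover have "(\<Sum>a\<in>A. Poly_Mapping.single a 1) \<in> M"
    proof -
      have "(\<Sum>v\<in>Q a. if v \<in> A then 1 else 0) = (1::nat)" if "a \<in> A" for a
      proof (cases "a \<in> F")
        case False
        then have "b a \<notin> A" "b a \<noteq> a" using bA[OF that False] AW that by auto
        with False that show ?thesis by (simp add: Q_def)
      qed (use that in \<open>simp add: Q_def\<close>)
      moreover have "Poly_Mapping.keys (\<Sum>a\<in>A. Poly_Mapping.single a (1::nat)) \<subseteq> \<Union> (Q ` A)"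
      proof
        fix v assume "v \<in> Poly_Mapping.keys (\<Sum>a\<in>A. Poly_Mapping.single a (1::nat))"
        then have "v \<in> A"
          unfolding in_keys_iff lookup_sum_single[OF finA] by (simp split: if_splits)
        then show "v \<in> \<Union> (Q ` A)" by (auto simp: Q_def)
      qed
      moreover have "Poly_Mapping.lookup (\<Sum>a\<in>A. Poly_Mapping.single a (1::nat)) =
          (\<lambda>v. if v \<in> A then 1 else 0)"
        by (rule ext) (rule lookup_sum_single[OF finA])
      ultimately show ?thesis
        by (simp add: M_def del: One_nat_def)
    qed
    ultimately show False by blast
  qed
  ultimately have H: "S.nonzero_cohomology V z I (card A)"
    unfolding S.nonzero_cohomology_def by blast
  have "\<exists>r\<in>S. var v * var v = r * z v" if "v \<in> V" for v
  proof (cases "v \<in> F")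
    case True
    then have "var v * var v = 1 * z v" by (simp add: z_def x_def)
    then show ?thesis using S.one_closed by blast
  next
    case False
    then have "var v * var v = x v * z v" by (simp add: z_def x_def)
    then show ?thesis using xS[OF that] by blast
  qed
  then show ?thesis
    unfolding V_def[symmetric] I_def[symmetric]
    using depth_quotient_le[OF idealI V, of z "card A"] zS H by (simp add: S_def)
qed

text \<open>
  The case of singleton parts only, where a missing transversal means that every further vertex has a
  neighbour in \<open>A\<close>.
\<close>

corollary depth_le_card_independent_dominating:
  assumes "pair_graph G" and A: "A \<subseteq> pverts G"
    and indep: "\<And>p q. p \<in> A \<Longrightarrow> q \<in> A \<Longrightarrow> (p, q) \<notin> parcs G"
    and dom: "\<And>v. v \<in> pverts G - A \<Longrightarrow> \<exists>a\<in>A. (v, a) \<in> parcs G"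
  shows "depth (polynomial_ring (pverts G) :: (('v \<Rightarrow>\<^sub>0 nat) \<Rightarrow>\<^sub>0 'k::field) ring)
      (graded_maximal_ideal (pverts G))
      (quotient_module (polynomial_ring (pverts G)) (edge_ideal G)) \<le> enat (card A)"
proof (rule depth_edge_ideal_le[OF assms(1) A, where F = A and U = "\<lambda>a. {a}" and b = id])
  fix u v assume "v \<in> pverts G - \<Union> ((\<lambda>a. {a}) ` A)" and u: "\<And>a. a \<in> A \<Longrightarrow> u a \<in> {a}"
  then obtain a where a: "a \<in> A" "(v, a) \<in> parcs G" using dom by auto
  then have "a \<in> insert v (u ` A)" using u[of a] by (metis image_eqI insertCI singletonD)
  with a(2) show "\<exists>p\<in>insert v (u ` A). \<exists>q\<in>insert v (u ` A). (p, q) \<in> parcs G"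
    by blast
qed (use A indep in auto)

section \<open>The strong product of a cycle and a path\<close>

definition near_cyclic :: "nat \<Rightarrow> nat \<Rightarrow> nat \<Rightarrow> bool" where
  "near_cyclic n i k \<longleftrightarrow> i = k \<or> k = i + 1 \<or> i = k + 1 \<or> (i = 1 \<and> k = n) \<or> (i = n \<and> k = 1)"

definition near :: "nat \<Rightarrow> nat \<Rightarrow> bool" where
  "near j l \<longleftrightarrow> j = l \<or> l = j + 1 \<or> j = l + 1"

lemma pverts_cycle_path_graph: "pverts (cycle_path_graph n m) = {1..n} \<times> {1..m}"
  by (simp add: cycle_path_graph_def strong_product_def cycle_graph_def path_graph_def)

lemma parcs_cycle_path_graph:
  "(p, q) \<in> parcs (cycle_path_graph n m) \<longleftrightarrow>
    p \<in> {1..n} \<times> {1..m} \<and> q \<in> {1..n} \<times> {1..m} \<and> p \<noteq> q \<and>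
    near_cyclic n (fst p) (fst q) \<and> near (snd p) (snd q)"
  by (cases p; cases q)
    (auto simp: cycle_path_graph_def strong_product_def cycle_graph_def path_graph_def
      near_cyclic_def near_def)

lemma card_multiples_of_3_below: "card {t. 3 * t < n} = (n + 2) div (3 :: nat)"
proof -
  have "{t. 3 * t < n} = {..<(n + 2) div 3}"
    by auto
  then show ?thesis by simp
qed

text \<open>
  An independent dominating set of the cycle: every third vertex from 1 on. For \<open>n \<equiv> 1\<close> modulo 3 the
  last of these would be \<open>n\<close>, which is adjacent to 1; the minimum moves it to \<open>n - 1\<close>.
\<close>

definition cycle_centres :: "nat \<Rightarrow> nat set" where
  "cycle_centres n = (\<lambda>t. min (3 * t + 1) (n - 1)) ` {t. 3 * t < n}"

lemma cycle_centres_subset: "n \<ge> 3 \<Longrightarrow> cycle_centres n \<subseteq> {1..n}"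
  by (auto simp: cycle_centres_def)

lemma card_cycle_centres: "n \<ge> 3 \<Longrightarrow> card (cycle_centres n) = (n + 2) div 3"
  unfolding cycle_centres_def
  by (subst card_image)
    (auto simp: inj_on_def min_def card_multiples_of_3_below split: if_splits, presburger)

lemma cycle_centres_not_near:
  assumes "n \<ge> 3" "i \<in> cycle_centres n" "k \<in> cycle_centres n" "i \<noteq> k"
  shows "\<not> near_cyclic n i k"
proof -
  obtain s t where st: "i = min (3 * s + 1) (n - 1)" "k = min (3 * t + 1) (n - 1)"
    "3 * s < n" "3 * t < n"
    using assms(2,3) unfolding cycle_centres_def by blast
  have far: "\<not> near_cyclic n a b \<and> \<not> near_cyclic n b a"
    if "s < t" "3 * t < n" "a = min (3 * s + 1) (n - 1)" "b = min (3 * t + 1) (n - 1)" for s t a b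
  proof -
    have "1 \<le> a" "a + 2 \<le> b" "b \<le> n - 1"
      unfolding that(3,4) using that(1,2) assms(1) by arith+
    with assms(1) show ?thesis by (auto simp: near_cyclic_def)
  qed
  have "s < t \<or> t < s" using st(1,2) assms(4) by (cases s t rule: linorder_cases) auto
  then show ?thesis using far st by blast
qed

lemma cycle_centres_dominate:
  assumes "n \<ge> 3" "c \<in> {1..n}"
  shows "\<exists>i\<in>cycle_centres n. near_cyclic n c i"
proof (cases "c = n \<and> n mod 3 = 0")
  case True
  have "1 \<in> cycle_centres n"
    using assms unfolding cycle_centres_def by (intro image_eqI[of _ _ 0]) auto
  with True show ?thesis by (auto simp: near_cyclic_def)
next
  case False
  define t where "t = c div 3"
  have "3 * t + c mod 3 = c" by (simp add: t_def)
  moreover have "c mod 3 \<noteq> 0 \<or> c < n" using False assms by auto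
  ultimately have "3 * t < n" using assms by auto
  then have "min (3 * t + 1) (n - 1) \<in> cycle_centres n"
    by (simp add: cycle_centres_def)
  moreover have "c = 3 * t \<or> c = 3 * t + 1 \<or> c = 3 * t + 2"
    unfolding t_def by linarith
  then have "near_cyclic n c (min (3 * t + 1) (n - 1))"
    using assms by (auto simp: near_cyclic_def min_def)
  ultimately show ?thesis by blast
qed

lemma depth_le_product_of_centres:
  assumes n: "n \<ge> 3" and X: "X \<subseteq> {1..m}"
    and sparse: "\<And>j l. j \<in> X \<Longrightarrow> l \<in> X \<Longrightarrow> j \<noteq> l \<Longrightarrow> \<not> near j l"
    and dom: "\<And>j. j \<in> {1..m} \<Longrightarrow> \<exists>l\<in>X. near j l"
  shows "depth (polynomial_ring ({1..n} \<times> {1..m}) :: ((nat \<times> nat \<Rightarrow>\<^sub>0 nat) \<Rightarrow>\<^sub>0 'k::field) ring)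
      (graded_maximal_ideal ({1..n} \<times> {1..m}))
      (quotient_module (polynomial_ring ({1..n} \<times> {1..m})) (edge_ideal (cycle_path_graph n m)))
    \<le> enat ((n + 2) div 3 * card X)"
proof -
  let ?A = "cycle_centres n \<times> X"
  have "depth (polynomial_ring (pverts (cycle_path_graph n m)) :: ((nat \<times> nat \<Rightarrow>\<^sub>0 nat) \<Rightarrow>\<^sub>0 'k) ring)
      (graded_maximal_ideal (pverts (cycle_path_graph n m)))
      (quotient_module (polynomial_ring (pverts (cycle_path_graph n m)))
        (edge_ideal (cycle_path_graph n m))) \<le> enat (card ?A)"
  proof (rule depth_le_card_independent_dominating[OF pair_graph_cycle_path_graph[OF n]])
    show sub: "?A \<subseteq> pverts (cycle_path_graph n m)"
      using cycle_centres_subset[OF n] X by (auto simp: pverts_cycle_path_graph)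
    show "(p, q) \<notin> parcs (cycle_path_graph n m)" if "p \<in> ?A" "q \<in> ?A" for p q
      using that cycle_centres_not_near[OF n, of "fst p" "fst q"] sparse[of "snd p" "snd q"]
      by (cases p; cases q) (auto simp: parcs_cycle_path_graph)
    show "\<exists>a\<in>?A. (v, a) \<in> parcs (cycle_path_graph n m)"
      if v: "v \<in> pverts (cycle_path_graph n m) - ?A" for v
    proof -
      obtain i j where ij: "v = (i, j)" "i \<in> {1..n}" "j \<in> {1..m}"
        using v by (auto simp: pverts_cycle_path_graph)
      obtain c l where "c \<in> cycle_centres n" "near_cyclic n i c" "l \<in> X" "near j l"
        using cycle_centres_dominate[OF n ij(2)] dom[OF ij(3)] by blast
      with v ij sub show ?thesis
        by (intro bexI[of _ "(c, l)"]) (auto simp: parcs_cycle_path_graph pverts_cycle_path_graph)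
    qed
  qed
  then show ?thesis
    by (simp add: pverts_cycle_path_graph card_cartesian_product card_cycle_centres[OF n])
qed

text \<open>
  The rows \<open>2, 5, 8, \<dots>\<close> dominate a path whose length is a multiple of 3, and otherwise the rows
  \<open>1, 4, 7, \<dots>\<close> do, since the last of them is then one of the last two rows.
\<close>

lemma depth_le_product_of_ceilings:
  assumes n: "n \<ge> 3" and m: "m \<ge> 1"
  shows "depth (polynomial_ring ({1..n} \<times> {1..m}) :: ((nat \<times> nat \<Rightarrow>\<^sub>0 nat) \<Rightarrow>\<^sub>0 'k::field) ring)
      (graded_maximal_ideal ({1..n} \<times> {1..m}))
      (quotient_module (polynomial_ring ({1..n} \<times> {1..m})) (edge_ideal (cycle_path_graph n m)))
    \<le> enat ((n + 2) div 3 * ((m + 2) div 3))"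
proof -
  define s where "s = (if m mod 3 = 0 then 2 else 1 :: nat)"
  define X where "X = (\<lambda>t. 3 * t + s) ` {t. 3 * t < m}"
  have "X \<subseteq> {1..m}"
  proof
    fix j assume "j \<in> X"
    then obtain t where "j = 3 * t + s" "3 * t < m" by (auto simp: X_def)
    then show "j \<in> {1..m}" by (simp add: s_def split: if_splits; presburger)
  qed
  moreover have "\<not> near j l" if "j \<in> X" "l \<in> X" "j \<noteq> l" for j l
    using that by (auto simp: X_def near_def; presburger)
  moreover have "\<exists>l\<in>X. near j l" if j: "j \<in> {1..m}" for j
  proof -
    have "\<exists>t. 3 * t < m \<and> near j (3 * t + s)"
    proof (cases "m mod 3 = 0")
      case True
      define t where "t = (j - 1) div 3"
      have "3 * t \<le> j - 1" "j - 1 \<le> 3 * t + 2"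
        unfolding t_def by linarith+
      then have "3 * t < m \<and> near j (3 * t + s)"
        using j True by (auto simp: near_def s_def)
      then show ?thesis ..
    next
      case False
      define t where "t = j div 3"
      have "3 * t + j mod 3 = j" by (simp add: t_def)
      moreover have "j mod 3 \<noteq> 0 \<or> j < m" using False j by auto
      moreover have "j mod 3 = 0 \<or> j mod 3 = 1 \<or> j mod 3 = 2" by linarith
      ultimately have "3 * t < m \<and> near j (3 * t + s)"
        using j False by (auto simp: near_def s_def)
      then show ?thesis ..
    qed
    then show ?thesis by (auto simp: X_def)
  qed
  ultimately have "depth (polynomial_ring ({1..n} \<times> {1..m}) :: ((nat \<times> nat \<Rightarrow>\<^sub>0 nat) \<Rightarrow>\<^sub>0 'k) ring)
      (graded_maximal_ideal ({1..n} \<times> {1..m}))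
      (quotient_module (polynomial_ring ({1..n} \<times> {1..m})) (edge_ideal (cycle_path_graph n m)))
    \<le> enat ((n + 2) div 3 * card X)"
    by (rule depth_le_product_of_centres[OF n])
  moreover have "card X = (m + 2) div 3"
    unfolding X_def by (subst card_image) (auto simp: inj_on_def card_multiples_of_3_below)
  ultimately show ?thesis by simp
qed

text \<open>
  An independent transversal is forced step by step around the cycle. The vertex \<open>c\<close> lies in no
  part, so it is \<open>n\<close> or some \<open>3 * i - 1\<close>; the latter is adjacent to both vertices of part \<open>i\<close>. If \<open>c = n\<close>, the first part
  must contribute 3 as 1 is adjacent to \<open>n\<close>, then the second must contribute 6 as 4 is adjacent to 3,
  and so on, until the last one contributes \<open>3 * k = n - 1\<close>, a neighbour of \<open>c\<close>.
\<close>

lemma cycle_no_independent_transversal: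
  assumes k: "k \<ge> 1" and n: "n = 3 * k + 1" and c: "c \<in> {1..n}"
    and c_notin: "\<And>i. i \<in> {1..k} \<Longrightarrow> c \<notin> {3 * i - 2, 3 * i}"
    and h: "\<And>i. i \<in> {1..k} \<Longrightarrow> h i \<in> {3 * i - 2, 3 * i}"
  shows "(\<exists>i\<in>{1..k}. near_cyclic n c (h i)) \<or>
    (\<exists>i\<in>{1..k}. \<exists>i'\<in>{1..k}. h i \<noteq> h i' \<and> near_cyclic n (h i) (h i'))"
proof (rule ccontr)
  assume neg: "\<not> ?thesis"
  then have not_c: "\<not> near_cyclic n c (h i)" if "i \<in> {1..k}" for i
    using that by blast
  have not_h: "\<not> near_cyclic n (h i) (h i')" if "i \<in> {1..k}" "i' \<in> {1..k}" "h i \<noteq> h i'" for i i'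
    using that neg by blast
  have "c = n"
  proof (rule ccontr)
    assume "c \<noteq> n"
    define i where "i = (c + 2) div 3"
    have i: "i \<in> {1..k}"
      using c \<open>c \<noteq> n\<close> n unfolding i_def atLeastAtMost_iff by presburger
    have "c = 3 * i - 2 \<or> c = 3 * i - 1 \<or> c = 3 * i"
      using c unfolding i_def atLeastAtMost_iff by presburger
    then have "c = 3 * i - 1"
      using c_notin[OF i] by blast
    then have "near_cyclic n c (h i)"
      using h[OF i] i by (auto simp: near_cyclic_def)
    with not_c[OF i] show False by blast
  qed
  have "h (Suc i) = 3 * Suc i" if "Suc i \<le> k" for i
    using that
  proof (induction i)
    case 0
    then show ?case
      using h[of 1] not_c[of 1] \<open>c = n\<close> by (auto simp: near_cyclic_def)
  next
    case (Suc i)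
    then have IH: "h (Suc i) = 3 * Suc i" by simp
    have "\<not> h (Suc (Suc i)) = 3 * Suc i + 1"
      using not_h[of "Suc i" "Suc (Suc i)"] Suc.prems IH by (auto simp: near_cyclic_def)
    then show ?case
      using h[of "Suc (Suc i)"] Suc.prems by auto
  qed
  from this[of "k - 1"] have "h k = 3 * k" using k by simp
  then show False
    using not_c[of k] k \<open>c = n\<close> n by (simp add: near_cyclic_def)
qed

text \<open>
  The rows after the first \<open>s\<close> come in blocks of three, dominated by \<open>F\<close>. On the first one or two rows the
  parts are the columns \<open>3 * i - 2\<close> and \<open>3 * i\<close>, represented by \<open>(3 * i, 1)\<close> with opposite vertex
  \<open>(3 * i - 1, 1)\<close>. With two rows the vertices of a column have the same closed neighbourhood, so
  taking both of them into the part leaves the argument for the cycle unchanged.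
\<close>

lemma depth_le_cycle_length_1_mod_3:
  assumes k: "k \<ge> 1" and n: "n = 3 * k + 1" and s: "s = 1 \<or> s = 2" and m: "m = 3 * q + s"
  shows "depth (polynomial_ring ({1..n} \<times> {1..m}) :: ((nat \<times> nat \<Rightarrow>\<^sub>0 nat) \<Rightarrow>\<^sub>0 'k::field) ring)
      (graded_maximal_ideal ({1..n} \<times> {1..m}))
      (quotient_module (polynomial_ring ({1..n} \<times> {1..m})) (edge_ideal (cycle_path_graph n m)))
    \<le> enat (k + q * (k + 1))"
proof -
  let ?G = "cycle_path_graph n m"
  have n3: "n \<ge> 3" using k n by simp
  define X where "X = (\<lambda>t. s + 2 + 3 * t) ` {..<q}"
  define F where "F = cycle_centres n \<times> X"
  define B where "B = (\<lambda>i. (3 * i, 1 :: nat)) ` {1..k}"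
  define A where "A = F \<union> B"
  define U where "U a = (if snd a > s then {a} else {fst a - 2, fst a} \<times> {1..s})" for a :: "nat \<times> nat"
  define b where "b a = (fst a - 1, snd a)" for a :: "nat \<times> nat"
  have X: "X \<subseteq> {s + 2..m}"
    using m by (auto simp: X_def)
  have X_near: "j = l" if "j \<in> X" "l \<in> X" "near j l" for j l
    using that by (auto simp: X_def near_def; presburger)
  have UF: "U a = {a}" if "a \<in> F" for a
    using that X by (auto simp: F_def U_def)
  have UB: "U (3 * i, 1) = {3 * i - 2, 3 * i} \<times> {1..s}" if "i \<in> {1..k}" for i
    using s by (auto simp: U_def)
  have disjFB: "F \<inter> B = {}"
    using X by (auto simp: F_def B_def)
  have AF: "A - F = B"
    using disjFB by (auto simp: A_def)
  have W: "\<Union> (U ` A) = F \<union> (\<Union>i\<in>{1..k}. {3 * i - 2, 3 * i} \<times> {1..s})"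
    unfolding A_def B_def using UF UB by auto
  have FV: "F \<subseteq> {1..n} \<times> {1..m}"
    using X cycle_centres_subset[OF n3] by (fastforce simp: F_def)
  have BV: "{3 * i - 2, 3 * i - 1, 3 * i} \<times> {1..s} \<subseteq> {1..n} \<times> {1..m}" if "i \<in> {1..k}" for i
    using that n m by auto
  have cardA: "card A = k + q * (k + 1)"
  proof -
    have "card X = q"
      unfolding X_def by (subst card_image) (auto simp: inj_on_def)
    then have "card F = q * (k + 1)"
      using card_cycle_centres[OF n3] n by (simp add: F_def card_cartesian_product)
    moreover have "card B = k"
      unfolding B_def by (subst card_image) (auto simp: inj_on_def)
    moreover have "finite F" using FV by (rule finite_subset) simp
    ultimately show ?thesis
      using disjFB by (simp add: A_def card_Un_disjoint B_def)
  qed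
  have "depth (polynomial_ring (pverts ?G) :: ((nat \<times> nat \<Rightarrow>\<^sub>0 nat) \<Rightarrow>\<^sub>0 'k) ring)
      (graded_maximal_ideal (pverts ?G))
      (quotient_module (polynomial_ring (pverts ?G)) (edge_ideal ?G)) \<le> enat (card A)"
  proof (rule depth_edge_ideal_le[OF pair_graph_cycle_path_graph[OF n3], where F = F and U = U and b = b])
    show "A \<subseteq> pverts ?G"
      using FV n m s by (auto simp: A_def B_def pverts_cycle_path_graph)
    show "F \<subseteq> A" by (simp add: A_def)
    show "a \<in> U a" if "a \<in> A" for a
      using that s UF[of a] by (auto simp: A_def B_def U_def)
    show "U a \<subseteq> pverts ?G" if a: "a \<in> A" for a
    proof (cases "a \<in> F")
      case True
      then show ?thesis using UF FV by (auto simp: pverts_cycle_path_graph)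
    next
      case False
      then obtain i where "i \<in> {1..k}" "a = (3 * i, 1)"
        using a by (auto simp: A_def B_def)
      then show ?thesis using UB[of i] BV[of i] by (auto simp: pverts_cycle_path_graph)
    qed
    show "U a = {a}" if "a \<in> F" for a
      using UF that .
    show "U a \<inter> U a' = {}" if "a \<in> A" "a' \<in> A" "a \<noteq> a'" for a a'
    proof -
      have "U a \<inter> U a' = {}" if "a \<in> F" "a' \<in> B" for a a'
        using that X UF UB by (auto simp: F_def B_def)
      moreover have "U a \<inter> U a' = {}" if a: "a \<in> B" "a' \<in> B" "a \<noteq> a'" for a a'
      proof -
        obtain i i' where i: "i \<in> {1..k}" "i' \<in> {1..k}" "a = (3 * i, 1)" "a' = (3 * i', 1)"
          using a(1,2) unfolding B_def by blast
        then have "i < i' \<or> i' < i"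
          using a(3) by auto
        then have "3 * i \<noteq> 3 * i' \<and> 3 * i - 2 \<noteq> 3 * i' - 2 \<and> 3 * i - 2 \<noteq> 3 * i' \<and> 3 * i \<noteq> 3 * i' - 2"
          using i(1,2) by auto
        then have "{3 * i - 2, 3 * i} \<inter> {3 * i' - 2, 3 * i'} = {}"
          by blast
        then show ?thesis
          unfolding i(3,4) UB[OF i(1)] UB[OF i(2)] by blast
      qed
      ultimately show ?thesis
        using that UF unfolding A_def by (metis Int_commute Un_iff disjoint_insert(2) inf_bot_right singletonD)
    qed
    show "b a \<in> pverts ?G - \<Union> (U ` A)" if "a \<in> A - F" for a
    proof -
      obtain i where i: "i \<in> {1..k}" "b a = (3 * i - 1, 1)"
        using \<open>a \<in> A - F\<close> by (auto simp: AF B_def b_def)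
      moreover have "b a \<notin> F" using i X by (auto simp: F_def)
      moreover have "3 * i - 1 \<noteq> 3 * i' - 2 \<and> 3 * i - 1 \<noteq> 3 * i'" if "i' \<in> {1..k}" for i'
        using i(1) that by (auto; presburger)
      moreover have "(3 * i - 1, 1) \<in> {1..n} \<times> {1..m}"
        using i(1) n m s by auto
      ultimately show ?thesis
        unfolding W pverts_cycle_path_graph by auto
    qed
    show "inj_on b (A - F)"
      unfolding AF by (auto simp: inj_on_def B_def b_def)
    show "(p, p') \<notin> parcs ?G"
      if a: "a \<in> A" "a' \<in> A" "a \<noteq> a'" and p: "p \<in> (if a \<in> F then {a} else {a, b a})"
        "p' \<in> (if a' \<in> F then {a'} else {a', b a'})" for a a' p p'
    proof -
      have FF: "\<not> (near_cyclic n (fst a) (fst a') \<and> near (snd a) (snd a'))"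
        if "a \<in> F" "a' \<in> F" "a \<noteq> a'" for a a'
        using that X_near cycle_centres_not_near[OF n3] unfolding F_def by fastforce
      have row: "snd p = 1" if "a \<in> B" "p \<in> {a, b a}" for a p
        using that by (auto simp: B_def b_def)
      have FB: "\<not> near (snd p) (snd p') \<and> \<not> near (snd p') (snd p)" if "p \<in> F" "snd p' = 1" for p p'
        using that X s by (auto simp: F_def near_def)
      have BB: "\<not> near_cyclic n (fst p) (fst p')"
        if a: "a \<in> B" "a' \<in> B" "a \<noteq> a'" and p: "p \<in> {a, b a}" "p' \<in> {a', b a'}" for a a' p p'
      proof -
        obtain i i' where i: "i \<in> {1..k}" "i' \<in> {1..k}" "a = (3 * i, 1)" "a' = (3 * i', 1)"
          using a(1,2) unfolding B_def by blast
        then have "i < i' \<or> i' < i" using \<open>a \<noteq> a'\<close> by auto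
        moreover have "fst p = 3 * i \<or> fst p = 3 * i - 1" "fst p' = 3 * i' \<or> fst p' = 3 * i' - 1"
          using p i by (auto simp: b_def)
        ultimately show ?thesis
          using i(1,2) n unfolding near_cyclic_def by (auto; presburger)
      qed
      have cases: "a \<in> F \<or> a \<in> B" "a' \<in> F \<or> a' \<in> B" using a by (auto simp: A_def)
      show ?thesis
        using cases FF[of a a'] FB[of p p'] FB[of p' p] BB[of a a' p p'] row[of a p] row[of a' p'] a p disjFB
        by (auto simp: parcs_cycle_path_graph split: if_splits)
    qed
    show "\<exists>p\<in>insert v (u ` A). \<exists>p'\<in>insert v (u ` A). (p, p') \<in> parcs ?G"
      if v: "v \<in> pverts ?G - \<Union> (U ` A)" and u: "\<And>a. a \<in> A \<Longrightarrow> u a \<in> U a" for v u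
    proof (rule ccontr)
      assume "\<not> ?thesis"
      then have none: "(p, p') \<notin> parcs ?G" if "p \<in> insert v (u ` A)" "p' \<in> insert v (u ` A)" for p p'
        using that by blast
      obtain c j where cj: "v = (c, j)" "c \<in> {1..n}" "j \<in> {1..m}"
        using v by (auto simp: pverts_cycle_path_graph)
      show False
      proof (cases "j \<le> s")
        case False
        define t where "t = (j - s - 1) div 3"
        have "t < q" "near j (s + 2 + 3 * t)"
          using False cj(3) m by (auto simp: t_def near_def; presburger)+
        moreover obtain d where "d \<in> cycle_centres n" "near_cyclic n c d"
          using cycle_centres_dominate[OF n3 cj(2)] by blast
        ultimately have a: "(d, s + 2 + 3 * t) \<in> F" (is "?a \<in> F")
          and "near_cyclic n c d" "near j (s + 2 + 3 * t)"
          by (auto simp: F_def X_def)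
        moreover have "u ?a = ?a" "?a \<in> u ` A"
          using u[of ?a] UF[OF a] a by (auto simp: A_def intro: rev_image_eqI)
        moreover have "v \<noteq> ?a" using v a by (auto simp: W)
        ultimately have "(v, ?a) \<in> parcs ?G"
          using cj FV by (auto simp: parcs_cycle_path_graph)
        with none \<open>?a \<in> u ` A\<close> show False by blast
      next
        case True
        have mem: "(3 * i, 1) \<in> A" if "i \<in> {1..k}" for i
          using that by (auto simp: A_def B_def)
        define h where "h i = fst (u (3 * i, 1))" for i
        have hu: "u (3 * i, 1) \<in> {3 * i - 2, 3 * i} \<times> {1..s}" if "i \<in> {1..k}" for i
          using u[OF mem[OF that]] UB[OF that] by simp
        then have h: "h i \<in> {3 * i - 2, 3 * i}" and rowu: "snd (u (3 * i, 1)) \<in> {1..s}"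
          if "i \<in> {1..k}" for i
          using that unfolding h_def mem_Times_iff by blast+
        have nearu: "near j' l" if "j' \<in> {1..s}" "l \<in> {1..s}" for j' l
          using that s by (auto simp: near_def)
        have uV: "u (3 * i, 1) \<in> {1..n} \<times> {1..m}" if "i \<in> {1..k}" for i
          by (rule subsetD[OF BV[OF that]]) (use hu[OF that] in \<open>auto simp: mem_Times_iff\<close>)
        have "c \<notin> {3 * i - 2, 3 * i}" if "i \<in> {1..k}" for i
        proof
          assume "c \<in> {3 * i - 2, 3 * i}"
          then have "v \<in> {3 * i - 2, 3 * i} \<times> {1..s}" using cj True by simp
          with that v show False unfolding W by blast
        qed
        then consider i where "i \<in> {1..k}" "near_cyclic n c (h i)"
          | i i' where "i \<in> {1..k}" "i' \<in> {1..k}" "h i \<noteq> h i'" "near_cyclic n (h i) (h i')"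
          using cycle_no_independent_transversal[OF k n cj(2), of h] h by blast
        then show False
        proof cases
          case 1
          have "v \<noteq> u (3 * i, 1)" using v u[OF mem[OF 1(1)]] mem[OF 1(1)] by blast
          then have "(v, u (3 * i, 1)) \<in> parcs ?G"
            using 1 cj True nearu[OF _ rowu[OF 1(1)], of j] uV[OF 1(1)]
            by (simp add: parcs_cycle_path_graph h_def)
          with none mem[OF 1(1)] show False by blast
        next
          case 2
          then have "(u (3 * i, 1), u (3 * i', 1)) \<in> parcs ?G"
            using nearu[OF rowu[OF 2(1)] rowu[OF 2(2)]] uV[OF 2(1)] uV[OF 2(2)]
            by (auto simp: parcs_cycle_path_graph h_def)
          with none mem[OF 2(1)] mem[OF 2(2)] show False by blast
        qed
      qed
    qed
  qed
  then show ?thesis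
    by (simp add: pverts_cycle_path_graph cardA)
qed

lemma ceiling_third: "\<lceil>real n / 3\<rceil> = int ((n + 2) div 3)"
proof (rule ceiling_unique)
  have "3 * ((n + 2) div 3) < n + 3" "n \<le> 3 * ((n + 2) div 3)" by linarith+
  then have "3 * real ((n + 2) div 3) < real n + 3" "real n \<le> 3 * real ((n + 2) div 3)" by linarith+
  then show "of_int (int ((n + 2) div 3)) - 1 < real n / 3" "real n / 3 \<le> of_int (int ((n + 2) div 3))"
    by simp_all
qed

theorem theorem5p4:
  fixes n m :: nat
  assumes "n \<ge> 3" and "m \<ge> 1"
  shows "depth
           (polynomial_ring ({1..n} \<times> {1..m}) :: ((nat \<times> nat \<Rightarrow>\<^sub>0 nat) \<Rightarrow>\<^sub>0 'k::field) ring)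
           (graded_maximal_ideal ({1..n} \<times> {1..m}))
           (quotient_module (polynomial_ring ({1..n} \<times> {1..m})) (edge_ideal (cycle_path_graph n m)))
         \<le> enat (nat (if m mod 3 = 1 \<or> m mod 3 = 2
                      then \<lceil>(real n - 1) / 3\<rceil> + (\<lceil>real m / 3\<rceil> - 1) * \<lceil>real n / 3\<rceil>
                      else \<lceil>real n / 3\<rceil> * \<lceil>real m / 3\<rceil>))"
proof -
  have ceil: "\<lceil>(real n - 1) / 3\<rceil> = int ((n + 1) div 3)"
    using ceiling_third[of "n - 1"] assms by (simp add: of_nat_diff)
  define k where "k = n div 3"
  define q where "q = m div 3"
  define s where "s = m mod 3"
  have nk: "n = 3 * k + n mod 3" and mq: "m = 3 * q + s"
    by (simp_all add: k_def q_def s_def)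
  show ?thesis
  proof (cases "n mod 3 = 1 \<and> s \<noteq> 0")
    case True
    have s: "s = 1 \<or> s = 2" using True by (auto simp: s_def)
    have "k \<ge> 1" "n = 3 * k + 1" using True nk assms by (auto simp: k_def)
    then have "(n + 1) div 3 = k" "(n + 2) div 3 = k + 1" "(m + 2) div 3 = q + 1"
      using mq s by auto
    then have "nat (\<lceil>(real n - 1) / 3\<rceil> + (\<lceil>real m / 3\<rceil> - 1) * \<lceil>real n / 3\<rceil>) = k + q * (k + 1)"
      unfolding ceil ceiling_third by (simp add: nat_add_distrib nat_mult_distrib flip: of_nat_add of_nat_mult)
    with s show ?thesis
      using depth_le_cycle_length_1_mod_3[OF \<open>k \<ge> 1\<close> \<open>n = 3 * k + 1\<close> s mq] by (simp add: s_def)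
  next
    case False
    have "nat (if m mod 3 = 1 \<or> m mod 3 = 2
        then \<lceil>(real n - 1) / 3\<rceil> + (\<lceil>real m / 3\<rceil> - 1) * \<lceil>real n / 3\<rceil>
        else \<lceil>real n / 3\<rceil> * \<lceil>real m / 3\<rceil>) = (n + 2) div 3 * ((m + 2) div 3)"
    proof (cases "s = 0")
      case True
      then show ?thesis
        unfolding ceiling_third by (simp add: s_def flip: of_nat_mult)
    next
      case s: False
      then have "(n + 1) div 3 = (n + 2) div 3"
        using False by (simp; presburger)
      moreover have "m mod 3 = 1 \<or> m mod 3 = 2" using s by (auto simp: s_def)
      moreover have "int a + (int b - 1) * int a = int (a * b)" for a b
        by (simp add: algebra_simps)
      ultimately show ?thesis
        unfolding ceil ceiling_third by (simp flip: of_nat_mult)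
    qed
    then show ?thesis
      using depth_le_product_of_ceilings[OF assms] by simp
  qed
qed

end
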